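(* Let $n\ge 3$. There exist a bounded domain $\Omega'\subset\mathbb{R}^n$, a domain $\Omega\subset\mathbb{R}^n$ that is $s$-John for any $s\in\left(1+\frac{1}{n-1},\infty\right)$, and a quasiconformal mapping $f:\Omega'\to\Omega$ (a homeomorphism of $\Omega'$ onto $\Omega$) such that $f$ is not uniformly continuous with respect to the Euclidean metric $d(x,y)=|x-y|$ in $\Omega$ and the internal metric $d_I$ in $\Omega'$; that is, $f:(\Omega',d_I)\to(\Omega,|\cdot|)$ is not uniformly continuous.
   Context: A domain is a nonempty open connected set. For $s\ge 1$, a bounded domain $\Omega\subset\mathbb{R}^n$ is an $s$-John domain (is $s$-John) if there are a constant $C$ and a point $x_0\in\Omega$ so that for each $x\in\Omega$ one can find a rectifiable curve $\gamma:[0,1]\to\Omega$ with $\gamma(0)=x$, $\gamma(1)=x_0$ and $$C\,d(\gamma(t),\partial\Omega)\ge l(\gamma([0,t]))^s\quad\text{for each } 0<t\le 1,$$ where $l$ denotes length and $d(\cdot,\partial\Omega)$ is the Euclidean distance to the boundary (the constant $C$ may depend on $s$). For a domain $G\subset\mathbb{R}^n$ and $z,w\in G$, the internal distance $d_I(z,w)$ is the infimum of the lengths of all paths that join $z$ to $w$ in $G$. A quasiconformal mapping is a homeomorphism between domains that is $K$-quasiconformal for some $K\ge1$ in the usual sense. *)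

theory Defs
  imports "HOL-Analysis.Analysis"
begin

definition is_domain :: "'a::topological_space set \<Rightarrow> bool" where
  "is_domain D \<longleftrightarrow> D \<noteq> {} \<and> open D \<and> connected D"

(* Length of g restricted to [a,b]: supremum of the lengths of inscribed polygons
   g (t 0), ..., g (t k) with a <= t 0 <= ... <= t k <= b; possibly infinite. *)
definition curve_length :: "(real \<Rightarrow> 'a::metric_space) \<Rightarrow> real \<Rightarrow> real \<Rightarrow> ennreal" where
  "curve_length g a b =
     (SUP (k, t) \<in> {(k, t :: nat \<Rightarrow> real). mono_on {..k} t \<and> t ` {..k} \<subseteq> {a..b}}.
        \<Sum>i<k. ennreal (dist (g (t i)) (g (t (Suc i)))))"

definition rectifiable_curve :: "(real \<Rightarrow> 'a::metric_space) \<Rightarrow> bool" where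
  "rectifiable_curve g \<longleftrightarrow> path g \<and> curve_length g 0 1 < \<infinity>"

(* The frontier of a nonempty bounded open set is nonempty, so infdist is the true distance. *)
definition s_John_domain :: "real \<Rightarrow> 'a::euclidean_space set \<Rightarrow> bool" where
  "s_John_domain s D \<longleftrightarrow> 1 \<le> s \<and> is_domain D \<and> bounded D \<and>
     (\<exists>C::real. \<exists>x0\<in>D. \<forall>x\<in>D. \<exists>g.
        rectifiable_curve g \<and> path_image g \<subseteq> D \<and> pathstart g = x \<and> pathfinish g = x0 \<and>
        (\<forall>t. 0 < t \<and> t \<le> 1 \<longrightarrow>
           C * infdist (g t) (frontier D) \<ge> enn2real (curve_length g 0 t) powr s))"

definition internal_dist :: "'a::metric_space set \<Rightarrow> 'a \<Rightarrow> 'a \<Rightarrow> ennreal" where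
  "internal_dist G z w =
     (INF g \<in> {g. path g \<and> path_image g \<subseteq> G \<and> pathstart g = z \<and> pathfinish g = w}.
        curve_length g 0 1)"

definition abs_continuous_on_interval :: "(real \<Rightarrow> 'a::metric_space) \<Rightarrow> real \<Rightarrow> real \<Rightarrow> bool" where
  "abs_continuous_on_interval g a b \<longleftrightarrow>
     (\<forall>\<epsilon>>0. \<exists>\<delta>>0. \<forall>(k::nat) (u::nat \<Rightarrow> real) (v::nat \<Rightarrow> real).
        (\<forall>i<k. a \<le> u i \<and> u i \<le> v i \<and> v i \<le> b) \<and>
        (\<forall>i<k. \<forall>j<k. i \<noteq> j \<longrightarrow> {u i<..<v i} \<inter> {u j<..<v j} = {}) \<and>
        (\<Sum>i<k. v i - u i) < \<delta> \<longrightarrow>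
        (\<Sum>i<k. dist (g (u i)) (g (v i))) < \<epsilon>)"

(* ACL (absolutely continuous on lines): for each closed box in D and each coordinate direction i,
   f is absolutely continuous on almost every segment of the box parallel to the i-th axis.
   The condition on x does not involve x $ i, so by Fubini "almost every" with respect to
   n-dimensional measure in the box is the same as with respect to (n-1)-dimensional measure
   on its face orthogonal to the i-th axis. *)
definition ACL_on :: "(real^'n::finite \<Rightarrow> 'b::metric_space) \<Rightarrow> (real^'n) set \<Rightarrow> bool" where
  "ACL_on f D \<longleftrightarrow>
     (\<forall>a b. cbox a b \<subseteq> D \<longrightarrow>
        (\<forall>i. AE x in lebesgue. x \<in> cbox a b \<longrightarrow>
           abs_continuous_on_interval (\<lambda>t. f (\<chi> j. if j = i then t else x $ j)) (a $ i) (b $ i)))"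

(* The analytic definition of quasiconformality (no orientation is imposed, hence the absolute
   value of the Jacobian). Local n-integrability of the derivative need not be required: it
   follows from the dilatation inequality, as the Jacobian of an a.e. differentiable
   homeomorphism is locally integrable. *)
definition K_quasiconformal ::
  "real \<Rightarrow> (real^'n::finite \<Rightarrow> real^'n) \<Rightarrow> (real^'n) set \<Rightarrow> (real^'n) set \<Rightarrow> bool" where
  "K_quasiconformal K f D D' \<longleftrightarrow>
     is_domain D \<and> is_domain D' \<and> (\<exists>g. homeomorphism D D' f g) \<and> ACL_on f D \<and>
     (AE x in lebesgue. x \<in> D \<longrightarrow>
        (\<exists>f'. (f has_derivative f') (at x) \<and>
              onorm f' ^ CARD('n) \<le> K * \<bar>det (matrix f')\<bar>))"

definition quasiconformal ::
  "(real^'n::finite \<Rightarrow> real^'n) \<Rightarrow> (real^'n) set \<Rightarrow> (real^'n) set \<Rightarrow> bool" where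
  "quasiconformal f D D' \<longleftrightarrow> (\<exists>K\<ge>1. K_quasiconformal K f D D')"

end

theory Submission
  imports Defs
begin

text \<open>
The target is a box with, for every \<open>k\<close>, a thin tunnel of length 1 joined to one face of the box by
\<open>N\<close> corridors whose mouths are spaced by \<open>1 / N\<close> along a segment. Up to factors negligible against
powers of \<open>N\<close>, the corridors have length \<open>1 / N\<close> and width \<open>N powr - (n / (n - 1))\<close>, so the John
condition holds for every exponent above \<open>n / (n - 1)\<close>. At the same time the conformal capacity
\<open>N (width / length) ^ (n - 1)\<close> of all the corridors together tends to 0. This leaves room for a map
that is the identity on the box and has dilatation bounded independently of \<open>k\<close>: its inverse turns
the corridors into tubes of length about 1 which widen while they fan out from the segment into an
\<open>(n - 1)\<close>-dimensional grid, and then narrow down again towards a copy of the tunnel scaled by a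
factor of about \<open>1 / N\<close>. The ends of the tunnel stay at distance 1 in the target, but their internal
distance in the source tends to 0.
\<close>

section \<open>Lipschitz maps and shears\<close>

text \<open>The exponent comes from a packing problem. Stretching a corridor of length about
  \<open>1 / N\<close> to length about 1 with bounded distortion multiplies its width by about
  \<open>N\<close> over most of its length, and \<open>N\<close> such tubes fit side by side only on
  a grid with \<open>N powr (1 / (n - 1))\<close> points in each of the \<open>n - 1\<close>
  directions; this allows a width of about \<open>N powr (- n / (n - 1))\<close>. The obstacle lies
  at the two ends, where all axes sit on one segment: the tubes have to leave it and come back to it
  without touching, while fattening no faster than bounded dilatation permits. Therefore the scaling
  profile and the position of the axes share one form, an affine function plus a multiple of
  \<open>z (1 - z)\<close>, and thickness and spacing can be compared summand by summand at every
  height. The source is never described by itself: it is a union of preimages of target pieces under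
  maps defined on the whole space. Gluing then comes down to two facts: the maps agree where source
  pieces overlap, and distinct points have distinct images.\<close>

lemma abs_continuous_of_locally_lipschitz:
  fixes g :: "real \<Rightarrow> 'a::metric_space"
  assumes loc: "\<And>t. t \<in> {a..b} \<Longrightarrow> \<exists>e>0. \<exists>L. L-lipschitz_on (cball t e \<inter> {a..b}) g"
  shows "abs_continuous_on_interval g a b"
proof -
  \<comment> \<open>A dummy parameter makes the library notion of local Lipschitz continuity
    applicable; compactness of the interval then gives a single constant.\<close>
  have "local_lipschitz {0::real} {a..b} (\<lambda>_. g)"
    unfolding local_lipschitz_def using loc by force
  then obtain L where L: "\<And>t. t \<in> {0::real} \<Longrightarrow> L-lipschitz_on {a..b} g"
    by (rule local_lipschitz_compact_implies_lipschitz) (auto intro: continuous_intros)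
  then have L0: "L \<ge> 0" and Ld: "\<And>x y. x \<in> {a..b} \<Longrightarrow> y \<in> {a..b} \<Longrightarrow> dist (g x) (g y) \<le> L * dist x y"
    by (auto simp: lipschitz_on_def)
  show ?thesis unfolding abs_continuous_on_interval_def
  proof (intro allI impI)
    fix \<epsilon> :: real assume e: "\<epsilon> > 0"
    show "\<exists>\<delta>>0. \<forall>(k::nat) (u::nat \<Rightarrow> real) v. (\<forall>i<k. a \<le> u i \<and> u i \<le> v i \<and> v i \<le> b) \<and>
        (\<forall>i<k. \<forall>j<k. i \<noteq> j \<longrightarrow> {u i<..<v i} \<inter> {u j<..<v j} = {}) \<and>
        (\<Sum>i<k. v i - u i) < \<delta> \<longrightarrow> (\<Sum>i<k. dist (g (u i)) (g (v i))) < \<epsilon>"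
    proof (intro exI[of _ "\<epsilon> / (L + 1)"] conjI allI impI)
      show "0 < \<epsilon> / (L + 1)" using e L0 by auto
      fix k :: nat and u v :: "nat \<Rightarrow> real"
      assume A: "(\<forall>i<k. a \<le> u i \<and> u i \<le> v i \<and> v i \<le> b) \<and>
        (\<forall>i<k. \<forall>j<k. i \<noteq> j \<longrightarrow> {u i<..<v i} \<inter> {u j<..<v j} = {}) \<and>
        (\<Sum>i<k. v i - u i) < \<epsilon> / (L + 1)"
      have "(\<Sum>i<k. dist (g (u i)) (g (v i))) \<le> (\<Sum>i<k. L * (v i - u i))"
        using A by (intro sum_mono order_trans[OF Ld]) (auto simp: dist_real_def)
      also have "\<dots> = L * (\<Sum>i<k. v i - u i)" by (simp add: sum_distrib_left)
      also have "\<dots> \<le> L * (\<epsilon> / (L + 1))" using A L0 by (intro mult_left_mono) auto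
      also have "\<dots> < \<epsilon>" using e L0 by (simp add: field_simps)
      finally show "(\<Sum>i<k. dist (g (u i)) (g (v i))) < \<epsilon>" .
    qed
  qed
qed

lemma lipschitz_vector_derivative:
  fixes g :: "real \<Rightarrow> 'a::real_normed_vector"
  assumes der: "\<And>x. x \<in> {a..b} \<Longrightarrow> (g has_vector_derivative g' x) (at x within {a..b})"
    and cont: "continuous_on {a..b} g'"
  shows "\<exists>L. L-lipschitz_on {a..b} g"
proof -
  have "bounded (g' ` {a..b})"
    using cont compact_Icc compact_continuous_image compact_imp_bounded by blast
  then obtain C where C: "C > 0" "\<And>x. x \<in> {a..b} \<Longrightarrow> norm (g' x) \<le> C"
    unfolding bounded_pos by auto
  have "C-lipschitz_on {a..b} g"
  proof (rule bounded_derivative_imp_lipschitz)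
    show "(g has_derivative (\<lambda>u. u *\<^sub>R g' x)) (at x within {a..b})" if "x \<in> {a..b}" for x
      using der[OF that] by (simp add: has_vector_derivative_def)
    show "onorm (\<lambda>u. u *\<^sub>R g' x) \<le> C" if "x \<in> {a..b}" for x
      by (rule onorm_le) (use C that in \<open>simp add: mult.commute[of C] mult_left_mono\<close>)
  qed (use C in auto)
  then show ?thesis by blast
qed

text \<open>Composition with \<open>clamp01\<close> extends a function on the unit interval by its
  end values, so that one formula covers the heights below 0, between 0 and 1, and above 1.\<close>

definition clamp01 :: "real \<Rightarrow> real" where "clamp01 h = max 0 (min 1 h)"

lemma clamp01_simps:
  "h \<le> 0 \<Longrightarrow> clamp01 h = 0" "1 \<le> h \<Longrightarrow> clamp01 h = 1" "0 \<le> h \<Longrightarrow> h \<le> 1 \<Longrightarrow> clamp01 h = h"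
  "0 \<le> clamp01 h" "clamp01 h \<le> 1" "clamp01 h \<in> {0..1}"
  by (auto simp: clamp01_def)

lemma continuous_clamp01: "continuous_on UNIV clamp01"
  unfolding clamp01_def by (intro continuous_intros)

lemma lipschitz_clamp01: "1-lipschitz_on UNIV clamp01"
  by (auto simp: lipschitz_on_def clamp01_def dist_real_def)

lemma lipschitz_comp_clamp01:
  assumes "L-lipschitz_on {0..1} g"
  shows "L-lipschitz_on UNIV (\<lambda>h. g (clamp01 h))"
proof -
  have "(L * 1)-lipschitz_on UNIV (\<lambda>h. g (clamp01 h))"
    by (rule lipschitz_on_compose2[OF lipschitz_clamp01])
       (rule lipschitz_on_subset[OF assms], auto simp: clamp01_simps)
  then show ?thesis by simp
qed

text \<open>The matrix of the shear is the identity with one column replaced, so Cramer's lemma gives its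
  determinant without an ordering of the index type.\<close>

lemma shear_det:
  fixes v :: "real^'n"
  assumes "v $ \<nu> = 0"
  shows "det (matrix (\<lambda>u. B *\<^sub>R (u + u $ \<nu> *\<^sub>R v))) = B ^ CARD('n)"
proof -
  let ?h = "\<lambda>u. u + u $ \<nu> *\<^sub>R v"
  have lin: "linear ?h"
    by (rule linearI) (auto simp: algebra_simps)
  have "matrix ?h = (\<chi> i j. if j = \<nu> then ((mat 1 :: real^'n^'n) *v (v + axis \<nu> 1)) $ i else (mat 1 :: real^'n^'n) $ i $ j)"
    using assms unfolding matrix_vector_mul_lid by (auto simp: matrix_def vec_eq_iff axis_def mat_def)
  then have "det (matrix ?h) = (v + axis \<nu> 1) $ \<nu> * det (mat 1 :: real^'n^'n)"
    by (simp only: cramer_lemma)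
  then have 1: "det (matrix ?h) = 1" using assms by simp
  have "matrix ((*\<^sub>R) B \<circ> ?h) = matrix ((*\<^sub>R) B) ** matrix ?h"
    by (intro matrix_compose lin) (auto simp: linear_iff algebra_simps)
  then show ?thesis by (simp add: o_def det_mul 1)
qed

lemma shear_onorm:
  fixes v :: "real^'n"
  assumes "0 \<le> B"
  shows "onorm (\<lambda>u. B *\<^sub>R (u + u $ \<nu> *\<^sub>R v)) \<le> B * (1 + norm v)"
proof (rule onorm_le)
  fix u :: "real^'n"
  have "norm (u + u $ \<nu> *\<^sub>R v) \<le> norm u + \<bar>u $ \<nu>\<bar> * norm v"
    by (metis norm_scaleR norm_triangle_ineq real_norm_def)
  also have "\<dots> \<le> norm u + norm u * norm v"
    by (intro add_left_mono mult_right_mono component_le_norm_cart) auto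
  finally have "norm (u + u $ \<nu> *\<^sub>R v) \<le> (1 + norm v) * norm u" by (simp add: algebra_simps)
  then show "norm (B *\<^sub>R (u + u $ \<nu> *\<^sub>R v)) \<le> B * (1 + norm v) * norm u"
    using assms by (simp add: mult.assoc mult_left_mono)
qed

text \<open>The power of \<open>B\<close> occurs on both sides and cancels. Only the slope
  \<open>v\<close> of the shear counts, which matters because the scale factors \<open>B\<close> of
  the construction are unbounded over all k.\<close>

lemma shear_dilatation:
  fixes v :: "real^'n"
  assumes "0 \<le> B" "v $ \<nu> = 0" "norm v \<le> V"
  shows "onorm (\<lambda>u. B *\<^sub>R (u + u $ \<nu> *\<^sub>R v)) ^ CARD('n)
    \<le> (1 + V) ^ CARD('n) * \<bar>det (matrix (\<lambda>u. B *\<^sub>R (u + u $ \<nu> *\<^sub>R v)))\<bar>"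
proof -
  have "onorm (\<lambda>u. B *\<^sub>R (u + u $ \<nu> *\<^sub>R v)) \<le> B * (1 + V)"
    using shear_onorm[of B \<nu> v] assms by (meson add_left_mono mult_left_mono order_trans)
  moreover have "bounded_linear (\<lambda>u. B *\<^sub>R (u + u $ \<nu> *\<^sub>R v))"
    by (intro linear_conv_bounded_linear[THEN iffD1] linearI) (auto simp: algebra_simps)
  ultimately have "onorm (\<lambda>u. B *\<^sub>R (u + u $ \<nu> *\<^sub>R v)) ^ CARD('n) \<le> (B * (1 + V)) ^ CARD('n)"
    by (intro power_mono onorm_pos_le)
  then show ?thesis using assms by (simp add: shear_det power_mult_distrib mult.commute)
qed

section \<open>Coordinates, boxes and elementary inequalities\<close>

lemma negligible_hyperplane_cart: "negligible {x::real^'n. x $ k = c}"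
proof -
  have "{x::real^'n. x $ k = c} = (+) (axis k c) ` {x. x $ k = 0}"
    by (force simp: image_iff axis_def intro: exI[of _ "_ - axis k c"])
  then show ?thesis by (simp add: negligible_translation negligible_standard_hyperplane_cart)
qed

lemma norm_le_card_mult:
  fixes v :: "real^'n"
  assumes "\<And>j. \<bar>v $ j\<bar> \<le> c"
  shows "norm v \<le> real CARD('n) * c"
proof -
  have "norm v \<le> (\<Sum>j\<in>UNIV. \<bar>v $ j\<bar>)" by (rule norm_le_l1_cart)
  also have "\<dots> \<le> (\<Sum>j\<in>(UNIV::'n set). c)" by (intro sum_mono assms)
  finally show ?thesis by simp
qed

lemma bounded_of_coordinates:
  fixes S :: "(real^'n) set"
  assumes "\<And>x j. x \<in> S \<Longrightarrow> \<bar>x $ j\<bar> \<le> c"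
  shows "bounded S"
  unfolding bounded_iff using norm_le_card_mult[of _ c] assms by blast

text \<open>Body, corridors and tunnels are all boxes of this shape, a degenerate box thickened by
  \<open>w\<close> on every side, so points of the core have clearance \<open>w\<close>.\<close>

lemma ball_subset_box:
  fixes q :: "real^'n"
  assumes "\<And>j. A $ j \<le> q $ j" "\<And>j. q $ j \<le> B $ j"
  shows "ball q w \<subseteq> box (A - vec w) (B + vec w)"
proof
  fix z assume z: "z \<in> ball q w"
  have "\<bar>z $ j - q $ j\<bar> < w" for j
    using component_le_norm_cart[of "z - q" j] z by (simp add: dist_norm norm_minus_commute)
  then have "q $ j - w < z $ j \<and> z $ j < q $ j + w" for j by (simp add: abs_less_iff algebra_simps)
  then show "z \<in> box (A - vec w) (B + vec w)"
    using assms by (simp add: mem_box_cart) (meson diff_right_mono add_right_mono le_less_trans less_le_trans)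
qed

lemma has_derivative_of_coordinate:
  assumes "(f has_real_derivative D) (at (x $ i))"
  shows "((\<lambda>y::real^'n. f (y $ i)) has_derivative (\<lambda>u. u $ i * D)) (at x)"
  by (rule DERIV_compose_FDERIV[where g = "\<lambda>y. y $ i", OF assms]) (intro bounded_linear_imp_has_derivative bounded_linear_vec_nth)

lemma parabola_bounds: "0 \<le> z \<Longrightarrow> z \<le> 1 \<Longrightarrow> 0 \<le> z * (1 - z) \<and> z * (1 - z) \<le> (1/4::real)"
  using zero_le_power2[of "z - 1/2"] mult_nonneg_nonneg[of z "1 - z"]
  by (simp add: power2_eq_square algebra_simps)

lemma quadratic_le:
  fixes a b x :: real
  assumes "0 < b"
  shows "a * x - b * x\<^sup>2 \<le> a\<^sup>2 / (4 * b)"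
proof -
  have "0 \<le> (a - 2 * b * x)\<^sup>2" by simp
  then have "(a * x - b * x\<^sup>2) * (4 * b) \<le> a\<^sup>2" by (simp add: power2_eq_square algebra_simps)
  then show ?thesis using assms by (simp add: pos_le_divide_eq)
qed

lemma powr_le_self:
  fixes s \<tau> :: real
  assumes "1 \<le> s" "0 \<le> \<tau>" "\<tau> \<le> 1"
  shows "\<tau> powr s \<le> \<tau>"
  using assms powr_mono'[of 1 s \<tau>] by (cases "\<tau> = 0") auto

section \<open>Length control and John curves\<close>

text \<open>Over an inscribed polygon the increments of \<phi> telescope, and monotonicity of
  \<phi>, itself a consequence of the control, bounds what is left.\<close>

lemma curve_length_le:
  assumes ctrl: "\<And>u v. u \<in> {a..b} \<Longrightarrow> v \<in> {a..b} \<Longrightarrow> u \<le> v \<Longrightarrow> dist (g u) (g v) \<le> \<phi> v - \<phi> u"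
    and "a \<le> b"
  shows "curve_length g a b \<le> ennreal (\<phi> b - \<phi> a)"
  unfolding curve_length_def
proof (rule SUP_least, clarify)
  fix k :: nat and t :: "nat \<Rightarrow> real"
  assume mono: "mono_on {..k} t" and sub: "t ` {..k} \<subseteq> {a..b}"
  have tin: "t i \<in> {a..b}" if "i \<le> k" for i using sub that by auto
  have mon: "\<phi> u \<le> \<phi> v" if "u \<in> {a..b}" "v \<in> {a..b}" "u \<le> v" for u v
    using ctrl[OF that] zero_le_dist[of "g u" "g v"] by linarith
  have "(\<Sum>i<k. ennreal (dist (g (t i)) (g (t (Suc i))))) = ennreal (\<Sum>i<k. dist (g (t i)) (g (t (Suc i))))"
    by simp
  also have "\<dots> \<le> ennreal (\<Sum>i<k. \<phi> (t (Suc i)) - \<phi> (t i))"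
    by (intro ennreal_leI sum_mono ctrl tin) (auto intro: mono_onD[OF mono])
  also have "(\<Sum>i<k. \<phi> (t (Suc i)) - \<phi> (t i)) = \<phi> (t k) - \<phi> (t 0)"
    by (rule sum_lessThan_telescope)
  also have "ennreal \<dots> \<le> ennreal (\<phi> b - \<phi> a)"
  proof -
    have "\<phi> (t k) \<le> \<phi> b" "\<phi> a \<le> \<phi> (t 0)"
      using tin[of k] tin[of 0] \<open>a \<le> b\<close> by (auto intro!: mon)
    then show ?thesis by (intro ennreal_leI) linarith
  qed
  finally show "(\<Sum>i<k. ennreal (dist (g (t i)) (g (t (Suc i))))) \<le> ennreal (\<phi> b - \<phi> a)" .
qed

lemma dist_linepath:
  fixes x y :: "'a::real_normed_vector"
  shows "dist (linepath x y u) (linepath x y v) = \<bar>u - v\<bar> * dist x y"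
proof -
  have "linepath x y u - linepath x y v = (u - v) *\<^sub>R (y - x)"
    by (simp add: linepath_def algebra_simps)
  then show ?thesis by (simp add: dist_norm norm_minus_commute)
qed

lemma internal_dist_le_dist:
  fixes x y :: "'a::real_normed_vector"
  assumes "closed_segment x y \<subseteq> G"
  shows "internal_dist G x y \<le> ennreal (dist x y)"
proof -
  have "internal_dist G x y \<le> curve_length (linepath x y) 0 1"
    unfolding internal_dist_def using assms by (intro INF_lower) auto
  also have "\<dots> \<le> ennreal (1 * dist x y - 0 * dist x y)"
    by (rule curve_length_le[where \<phi> = "\<lambda>t. t * dist x y"]) (auto simp: dist_linepath algebra_simps)
  finally show ?thesis by simp
qed

lemma infdist_frontier_ge:
  fixes D :: "'a::euclidean_space set"
  assumes "open D" "bounded D" "D \<noteq> {}" "ball z r \<subseteq> D"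
  shows "r \<le> infdist z (frontier D)"
proof -
  \<comment> \<open>\<open>infdist\<close> to the empty set is 0 by convention, so the lower bound
    relies on boundedness to provide a frontier point.\<close>
  have ne: "frontier D \<noteq> {}" using assms not_bounded_UNIV frontier_not_empty by metis
  have "r \<le> dist z y" if "y \<in> frontier D" for y
  proof -
    have "y \<notin> D" using that \<open>open D\<close> by (simp add: frontier_def interior_open)
    then show ?thesis using assms(4) by (metis in_mono linorder_not_le mem_ball)
  qed
  then show ?thesis using ne unfolding infdist_def by (auto intro: cINF_greatest)
qed

text \<open>\<open>L\<close> is the length already travelled before \<open>x\<close>; \<open>\<phi>\<close> dominates the arc length, so that no exact
  lengths have to be computed.\<close>

definition john_curve :: "real \<Rightarrow> real \<Rightarrow> 'a::euclidean_space set \<Rightarrow> 'a \<Rightarrow> real \<Rightarrow> 'a \<Rightarrow> bool" where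
  "john_curve C s D x0 L x \<longleftrightarrow> (\<exists>g \<phi>. path g \<and> path_image g \<subseteq> D \<and> pathstart g = x \<and> pathfinish g = x0 \<and>
     \<phi> 0 = 0 \<and> (\<forall>u\<in>{0..1}. \<forall>v\<in>{0..1}. u \<le> v \<longrightarrow> dist (g u) (g v) \<le> \<phi> v - \<phi> u) \<and>
     (\<forall>t\<in>{0..1}. (L + \<phi> t) powr s \<le> C * infdist (g t) (frontier D)))"

lemma john_curve_center:
  assumes "x0 \<in> D" "L powr s \<le> C * infdist x0 (frontier D)"
  shows "john_curve C s D x0 L x0"
  unfolding john_curve_def
  by (rule exI[of _ "\<lambda>_. x0"], rule exI[of _ "\<lambda>_. 0"])
     (use assms in \<open>auto simp: path_def pathstart_def pathfinish_def path_image_def\<close>)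

lemma john_curve_mono:
  assumes "john_curve C s D x0 L x" "0 \<le> L'" "L' \<le> L" "0 \<le> s"
  shows "john_curve C s D x0 L' x"
proof -
  obtain g \<phi> where g: "path g" "path_image g \<subseteq> D" "pathstart g = x" "pathfinish g = x0" "\<phi> 0 = 0"
    and ctrl: "\<And>u v. u\<in>{0..1} \<Longrightarrow> v\<in>{0..1} \<Longrightarrow> u \<le> v \<Longrightarrow> dist (g u) (g v) \<le> \<phi> v - \<phi> u"
    and J: "\<And>t. t\<in>{0..1} \<Longrightarrow> (L + \<phi> t) powr s \<le> C * infdist (g t) (frontier D)"
    using assms(1) unfolding john_curve_def by metis
  have "(L' + \<phi> t) powr s \<le> C * infdist (g t) (frontier D)" if t: "t \<in> {0..1}" for t
  proof -
    have "0 \<le> \<phi> t" using ctrl[of 0 t] t g(5) zero_le_dist[of "g 0" "g t"] by (simp del: zero_le_dist)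
    then have "(L' + \<phi> t) powr s \<le> (L + \<phi> t) powr s" using assms by (intro powr_mono2) auto
    then show ?thesis using J[OF t] by linarith
  qed
  then show ?thesis unfolding john_curve_def using g ctrl by (intro exI[of _ g] exI[of _ \<phi>]) auto
qed

text \<open>John curves are assembled backwards from the center: the curve from y has to tolerate
  the length of the segment that is put in front of it, which is why its initial length is
  \<open>L + dist x y\<close>.\<close>

lemma john_curve_segment:
  assumes J: "john_curve C s D x0 (L + dist x y) y"
    and seg: "closed_segment x y \<subseteq> D"
    and leg: "\<And>\<tau>. 0 \<le> \<tau> \<Longrightarrow> \<tau> \<le> 1 \<Longrightarrow>
      (L + \<tau> * dist x y) powr s \<le> C * infdist (linepath x y \<tau>) (frontier D)"
  shows "john_curve C s D x0 L x"
proof -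
  obtain g \<phi> where g: "path g" "path_image g \<subseteq> D" "pathstart g = y" "pathfinish g = x0" "\<phi> 0 = 0"
    and ctrl: "\<And>u v. u\<in>{0..1} \<Longrightarrow> v\<in>{0..1} \<Longrightarrow> u \<le> v \<Longrightarrow> dist (g u) (g v) \<le> \<phi> v - \<phi> u"
    and J: "\<And>t. t\<in>{0..1} \<Longrightarrow> (L + dist x y + \<phi> t) powr s \<le> C * infdist (g t) (frontier D)"
    using J unfolding john_curve_def by metis
  define d where "d = dist x y"
  define h where "h = linepath x y +++ g"
  define \<psi> where "\<psi> t = (if t \<le> 1/2 then (2 * t) * d else d + \<phi> (2 * t - 1))" for t
  have g0: "g 0 = y" using g(3) by (simp add: pathstart_def)
  have h1: "h t = linepath x y (2 * t)" if "t \<le> 1/2" for t using that by (simp add: h_def joinpaths_def)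
  have h2: "h t = g (2 * t - 1)" if "\<not> t \<le> 1/2" for t using that by (simp add: h_def joinpaths_def)
  have "dist (h u) (h v) \<le> \<psi> v - \<psi> u" if uv: "u \<in> {0..1}" "v \<in> {0..1}" "u \<le> v" for u v
  proof -
    consider "v \<le> 1/2" | "u \<le> 1/2" "\<not> v \<le> 1/2" | "\<not> u \<le> 1/2" by linarith
    then show ?thesis
    proof cases
      case 1
      then show ?thesis using uv by (simp add: h1 \<psi>_def dist_linepath d_def abs_if algebra_simps)
    next
      case 2
      have "dist (h u) (h v) \<le> dist (h u) y + dist y (h v)" by (rule dist_triangle)
      moreover have "dist (h u) y = \<bar>2 * u - 1\<bar> * d"
        using dist_linepath[of x y "2 * u" 1] 2 by (simp add: h1 linepath_1' d_def)
      moreover have "dist y (h v) \<le> \<phi> (2 * v - 1) - \<phi> 0"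
        using ctrl[of 0 "2 * v - 1"] 2 uv by (simp add: h2 g0)
      ultimately show ?thesis using 2 g(5) uv by (simp add: \<psi>_def abs_if algebra_simps split: if_splits)
    next
      case 3
      then show ?thesis using ctrl[of "2 * u - 1" "2 * v - 1"] uv by (simp add: \<psi>_def h2)
    qed
  qed
  moreover have "(L + \<psi> t) powr s \<le> C * infdist (h t) (frontier D)" if "t \<in> {0..1}" for t
    using leg[of "2 * t"] J[of "2 * t - 1"] that by (auto simp: \<psi>_def h1 h2 d_def add.assoc)
  moreover have "path h" "path_image h \<subseteq> D" "pathstart h = x" "pathfinish h = x0" "\<psi> 0 = 0"
    using g seg by (auto simp: h_def \<psi>_def path_image_join)
  ultimately show ?thesis unfolding john_curve_def by blast
qed

lemma s_John_domainI:
  assumes "1 \<le> s" "is_domain D" "bounded D" "x0 \<in> D"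
    and J: "\<And>x. x \<in> D \<Longrightarrow> john_curve C s D x0 0 x"
  shows "s_John_domain s D"
  unfolding s_John_domain_def
proof (intro conjI exI[of _ C] bexI[of _ x0] ballI)
  fix x assume "x \<in> D"
  then obtain g \<phi> where g: "path g" "path_image g \<subseteq> D" "pathstart g = x" "pathfinish g = x0" "\<phi> 0 = 0"
    and ctrl: "\<And>u v. u\<in>{0..1} \<Longrightarrow> v\<in>{0..1} \<Longrightarrow> u \<le> v \<Longrightarrow> dist (g u) (g v) \<le> \<phi> v - \<phi> u"
    and J: "\<And>t. t\<in>{0..1} \<Longrightarrow> (\<phi> t) powr s \<le> C * infdist (g t) (frontier D)"
    using J[of x] unfolding john_curve_def add_0 by metis
  have len: "curve_length g 0 t \<le> ennreal (\<phi> t)" if "t \<in> {0..1}" for t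
    using curve_length_le[of 0 t g \<phi>] ctrl that g(5) by auto
  have "enn2real (curve_length g 0 t) powr s \<le> C * infdist (g t) (frontier D)" if "0 < t" "t \<le> 1" for t
  proof -
    have "0 \<le> \<phi> t" using ctrl[of 0 t] that g(5) zero_le_dist[of "g 0" "g t"] by (simp del: zero_le_dist)
    then have "enn2real (curve_length g 0 t) \<le> \<phi> t" using len[of t] that by (intro enn2real_leI) auto
    then have "enn2real (curve_length g 0 t) powr s \<le> \<phi> t powr s"
      using assms(1) by (intro powr_mono2) auto
    then show ?thesis using J[of t] that by auto
  qed
  moreover have "rectifiable_curve g"
    unfolding rectifiable_curve_def using g(1) le_less_trans[OF len[of 1] ennreal_less_top] by simp
  ultimately show "\<exists>g. rectifiable_curve g \<and> path_image g \<subseteq> D \<and> pathstart g = x \<and> pathfinish g = x0 \<and>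
        (\<forall>t. 0 < t \<and> t \<le> 1 \<longrightarrow>
           C * infdist (g t) (frontier D) \<ge> enn2real (curve_length g 0 t) powr s)"
    using g by blast
qed (use assms in auto)

text \<open>The homothety with center x and ratio \<tau> maps the ball around q into S, so the
  clearance along the segment from x to q grows at least linearly.\<close>

lemma ball_toward_subset_convex:
  fixes S :: "'a::real_normed_vector set"
  assumes "convex S" "x \<in> S" "ball q r \<subseteq> S" "0 \<le> \<tau>" "\<tau> \<le> 1"
  shows "ball (linepath x q \<tau>) (\<tau> * r) \<subseteq> S"
proof
  fix z assume z: "z \<in> ball (linepath x q \<tau>) (\<tau> * r)"
  show "z \<in> S"
  proof (cases "\<tau> = 0")
    case True then show ?thesis using z by simp
  next
    case False
    then have l: "\<tau> > 0" using assms by simp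
    \<comment> \<open>The preimage of z under that homothety.\<close>
    define y where "y = q + (1 / \<tau>) *\<^sub>R (z - linepath x q \<tau>)"
    have "dist q y = (1 / \<tau>) * dist (linepath x q \<tau>) z"
      using l by (simp add: y_def dist_norm norm_minus_commute)
    also have "\<dots> < r" using z l by (simp add: field_simps)
    finally have "y \<in> S" using assms(3) by auto
    moreover have "z = (1 - \<tau>) *\<^sub>R x + \<tau> *\<^sub>R y"
      using l by (simp add: y_def linepath_def algebra_simps)
    ultimately show ?thesis using assms by (simp add: convexD_alt)
  qed
qed

section \<open>The scaling profile of a tube\<close>

text \<open>\<open>profile\<close> is quadratic with \<open>profile \<kappa> 0 = 1\<close>, \<open>profile \<kappa> 1\<close> comparable to \<open>\<kappa>\<close>, and height about
  \<open>1 / \<kappa>\<close> in between. Partial fractions turn the antiderivative \<open>depth\<close> of \<open>1 / profile\<close> into a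
  difference of logarithms; thus \<open>depth \<kappa> 1\<close> is only about \<open>\<kappa> ln (1 / \<kappa>)\<close>.\<close>

definition profile :: "real \<Rightarrow> real \<Rightarrow> real" where
  "profile \<kappa> z = (\<kappa> + z) * (\<kappa>\<^sup>2 + 1 - z) / (\<kappa> * (1 + \<kappa>\<^sup>2))"

definition end_scale :: "real \<Rightarrow> real" where "end_scale \<kappa> = profile \<kappa> 1"

definition shrink :: "real \<Rightarrow> real \<Rightarrow> real" where "shrink \<kappa> z = 1 - z + end_scale \<kappa> * z"

lemma shrink_deriv: "(shrink \<kappa> has_real_derivative end_scale \<kappa> - 1) (at z within S)"
  unfolding shrink_def[abs_def] by (auto intro!: derivative_eq_intros)

definition depth :: "real \<Rightarrow> real \<Rightarrow> real" where
  "depth \<kappa> z = \<kappa> * (1 + \<kappa>\<^sup>2) / (1 + \<kappa> + \<kappa>\<^sup>2) *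
     (ln ((\<kappa> + z) / \<kappa>) - ln ((\<kappa>\<^sup>2 + 1 - z) / (\<kappa>\<^sup>2 + 1)))"

text \<open>The three summands vary on the heights below 0, between 0 and 1, and above 1
  respectively, with slopes 1, \<open>1 / profile\<close> and \<open>1 / end_scale\<close>; the
  slopes match at 0 and at 1.\<close>

definition height :: "real \<Rightarrow> real \<Rightarrow> real" where
  "height \<kappa> h = min h 0 + depth \<kappa> (clamp01 h) + max (h - 1) 0 / end_scale \<kappa>"

context
  fixes \<kappa> :: real
  assumes k: "0 < \<kappa>" "\<kappa> \<le> 1/4"
begin

lemma one_plus_sq_pos: "0 < 1 + \<kappa>\<^sup>2" by (simp add: add_pos_nonneg)

lemma profile_0: "profile \<kappa> 0 = 1"
  using k one_plus_sq_pos by (simp add: profile_def add.commute)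

lemma kappa_z_pos: "0 \<le> z \<Longrightarrow> 0 < \<kappa> + z" "z \<le> 1 \<Longrightarrow> 0 < \<kappa>\<^sup>2 + 1 - z"
proof -
  have "0 < \<kappa>\<^sup>2" using k by simp
  then show "z \<le> 1 \<Longrightarrow> 0 < \<kappa>\<^sup>2 + 1 - z" by linarith
qed (use k in linarith)

lemma profile_pos: "0 \<le> z \<Longrightarrow> z \<le> 1 \<Longrightarrow> 0 < profile \<kappa> z"
  unfolding profile_def by (intro divide_pos_pos mult_pos_pos kappa_z_pos k one_plus_sq_pos)

lemma end_scale_eq: "end_scale \<kappa> = \<kappa> * (1 + \<kappa>) / (1 + \<kappa>\<^sup>2)"
proof -
  have "end_scale \<kappa> = \<kappa> * (\<kappa> * (1 + \<kappa>)) / (\<kappa> * (1 + \<kappa>\<^sup>2))"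
    by (simp add: end_scale_def profile_def power2_eq_square algebra_simps)
  then show ?thesis using k by simp
qed

lemma end_scale_pos: "0 < end_scale \<kappa>" using profile_pos[of 1] by (simp add: end_scale_def)

lemma end_scale_le: "end_scale \<kappa> \<le> 2 * \<kappa>"
proof -
  have "1 + \<kappa> \<le> 2 * (1 + \<kappa>\<^sup>2)"
    using k one_plus_sq_pos by (simp add: algebra_simps) (use k zero_le_power2[of \<kappa>] in linarith)
  then have "\<kappa> * (1 + \<kappa>) \<le> \<kappa> * (2 * (1 + \<kappa>\<^sup>2))"
    using k by (intro mult_left_mono) auto
  then show ?thesis using one_plus_sq_pos by (simp add: end_scale_eq pos_divide_le_eq algebra_simps)
qed

lemma end_scale_le_1: "end_scale \<kappa> \<le> 1" using end_scale_le k by linarith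

text \<open>The affine interpolation of the end values plus a parabola vanishing at both ends.
  \<open>tube_axis\<close> has the same two weights \<open>shrink\<close> and
  \<open>z * (1 - z)\<close>, so the thickness of a tube can be compared with the distance of the
  axes term by term.\<close>

lemma profile_eq: "profile \<kappa> z = shrink \<kappa> z + z * (1 - z) / (\<kappa> * (1 + \<kappa>\<^sup>2))"
proof -
  define D where "D = \<kappa> * (1 + \<kappa>\<^sup>2)"
  have D: "D \<noteq> 0" using k one_plus_sq_pos by (auto simp: D_def)
  have c: "end_scale \<kappa> = (\<kappa> + 1) * \<kappa>\<^sup>2 / D" by (simp add: end_scale_def profile_def D_def)
  have "(\<kappa> + z) * (\<kappa>\<^sup>2 + 1 - z) = (1 - z) * D + (\<kappa> + 1) * \<kappa>\<^sup>2 * z + z * (1 - z)"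
    by (simp add: D_def power2_eq_square algebra_simps)
  then have "profile \<kappa> z = ((1 - z) * D + (\<kappa> + 1) * \<kappa>\<^sup>2 * z + z * (1 - z)) / D"
    by (simp add: profile_def D_def)
  also have "\<dots> = shrink \<kappa> z + z * (1 - z) / D"
    using D unfolding shrink_def c by (simp add: add_divide_distrib)
  finally show ?thesis by (simp add: D_def)
qed

lemma shrink_bounds: "0 \<le> z \<Longrightarrow> z \<le> 1 \<Longrightarrow> 0 < shrink \<kappa> z" "0 \<le> z \<Longrightarrow> z \<le> 1 \<Longrightarrow> shrink \<kappa> z \<le> 1"
proof -
  assume z: "0 \<le> z" "z \<le> 1"
  show "0 < shrink \<kappa> z"
    using z end_scale_pos by (cases "z = 1") (auto simp: shrink_def intro: add_pos_nonneg)
  show "shrink \<kappa> z \<le> 1" using z mult_right_mono[OF end_scale_le_1, of z] by (simp add: shrink_def)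
qed

lemma inverse_prod_le: "1 / (\<kappa> * (1 + \<kappa>\<^sup>2)) \<le> 1 / \<kappa>"
  using k by (intro divide_left_mono) (auto intro!: mult_pos_pos add_pos_nonneg)

lemma profile_le:
  assumes z: "0 \<le> z" "z \<le> 1"
  shows "profile \<kappa> z \<le> shrink \<kappa> z + z * (1 - z) / \<kappa>"
proof -
  have "z * (1 - z) * (1 / (\<kappa> * (1 + \<kappa>\<^sup>2))) \<le> z * (1 - z) * (1 / \<kappa>)"
    using z by (intro mult_left_mono inverse_prod_le) auto
  then show ?thesis unfolding profile_eq by simp
qed

definition profile' :: "real \<Rightarrow> real" where
  "profile' z = (end_scale \<kappa> - 1) + (1 - 2 * z) / (\<kappa> * (1 + \<kappa>\<^sup>2))"

lemma profile_deriv: "(profile \<kappa> has_real_derivative profile' z) (at z within S)"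
proof -
  have "profile \<kappa> = (\<lambda>z. 1 - z + end_scale \<kappa> * z + z * (1 - z) / (\<kappa> * (1 + \<kappa>\<^sup>2)))"
    by (rule ext) (simp add: profile_eq shrink_def)
  then show ?thesis unfolding profile'_def
    using k one_plus_sq_pos
    by (auto intro!: derivative_eq_intros simp: diff_divide_distrib add_divide_distrib)
qed

lemma profile'_le:
  assumes z: "0 \<le> z" "z \<le> 1"
  shows "\<bar>profile' z\<bar> \<le> 1 + 1 / \<kappa>"
proof -
  have 1: "\<bar>end_scale \<kappa> - 1\<bar> \<le> 1" using end_scale_pos end_scale_le_1 by auto
  have "\<bar>(1 - 2 * z) * (1 / (\<kappa> * (1 + \<kappa>\<^sup>2)))\<bar> \<le> 1 * (1 / (\<kappa> * (1 + \<kappa>\<^sup>2)))"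
    unfolding abs_mult using z k one_plus_sq_pos by (intro mult_mono) auto
  then have "\<bar>(1 - 2 * z) / (\<kappa> * (1 + \<kappa>\<^sup>2))\<bar> \<le> 1 / \<kappa>"
    using inverse_prod_le by simp
  then show ?thesis using 1 unfolding profile'_def by linarith
qed

lemma depth_deriv:
  assumes z: "0 \<le> z" "z \<le> 1"
  shows "(depth \<kappa> has_real_derivative 1 / profile \<kappa> z) (at z within S)"
proof -
  have p: "0 < \<kappa> + z" "0 < \<kappa>\<^sup>2 + 1 - z" "0 < \<kappa>\<^sup>2 + 1" "0 < 1 + \<kappa> + \<kappa>\<^sup>2" "0 < \<kappa>"
    using kappa_z_pos z one_plus_sq_pos k by (auto simp: add_pos_nonneg)
  have "(depth \<kappa> has_real_derivative
      \<kappa> * (1 + \<kappa>\<^sup>2) / (1 + \<kappa> + \<kappa>\<^sup>2) * (1 / (\<kappa> + z) + 1 / (\<kappa>\<^sup>2 + 1 - z))) (at z within S)"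
    unfolding depth_def[abs_def]
  proof (rule DERIV_cmult)
    have "((\<lambda>z. ln ((\<kappa> + z) / \<kappa>)) has_real_derivative 1 / (\<kappa> + z)) (at z within S)"
      using p by (auto intro!: derivative_eq_intros simp: divide_simps)
    moreover have "((\<lambda>z. ln ((\<kappa>\<^sup>2 + 1 - z) / (\<kappa>\<^sup>2 + 1))) has_real_derivative - (1 / (\<kappa>\<^sup>2 + 1 - z))) (at z within S)"
      using p by (auto intro!: derivative_eq_intros simp: divide_simps)
    ultimately show "((\<lambda>z. ln ((\<kappa> + z) / \<kappa>) - ln ((\<kappa>\<^sup>2 + 1 - z) / (\<kappa>\<^sup>2 + 1))) has_real_derivative
        1 / (\<kappa> + z) + 1 / (\<kappa>\<^sup>2 + 1 - z)) (at z within S)"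
      by (rule DERIV_diff[THEN DERIV_cong]) simp
  qed
  \<comment> \<open>The two denominators add up to a constant, which is the normalising divisor in
    \<open>depth\<close>.\<close>
  moreover have "1 / (\<kappa> + z) + 1 / (\<kappa>\<^sup>2 + 1 - z) = (1 + \<kappa> + \<kappa>\<^sup>2) / ((\<kappa> + z) * (\<kappa>\<^sup>2 + 1 - z))"
    using p by (simp add: divide_simps)
  ultimately show ?thesis using p by (simp add: profile_def)
qed

lemma depth_0: "depth \<kappa> 0 = 0"
  using k one_plus_sq_pos by (simp add: depth_def add.commute)

lemma depth_strict_mono:
  assumes "0 \<le> z" "z < z'" "z' \<le> 1"
  shows "depth \<kappa> z < depth \<kappa> z'"
proof (rule DERIV_pos_imp_increasing[OF assms(2)])
  fix x assume "z \<le> x" "x \<le> z'"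
  then show "\<exists>y. (depth \<kappa> has_real_derivative y) (at x) \<and> 0 < y"
    using depth_deriv[of x UNIV] profile_pos[of x] assms by (intro exI[of _ "1 / profile \<kappa> x"]) auto
qed

lemma depth_continuous: "continuous_on {0..1} (depth \<kappa>)"
  using depth_deriv by (intro DERIV_continuous_on) auto

lemma depth_1_pos: "0 < depth \<kappa> 1" using depth_strict_mono[of 0 1] depth_0 by simp

text \<open>At 1 the first logarithm is about \<open>ln (1 / \<kappa>)\<close> and the second about
  \<open>- 2 * ln (1 / \<kappa>)\<close>, because one zero of the profile is at distance \<kappa>
  from the unit interval and the other at distance \<kappa> squared. This gives the factor 3; the 2
  absorbs two copies of \<open>ln 2\<close>.\<close>

lemma depth_1_le: "depth \<kappa> 1 \<le> \<kappa> * (2 + 3 * ln (1 / \<kappa>))"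
proof -
  have l2: "ln (2::real) \<le> 1" using ln_le_minus_one[of 2] by simp
  have a: "ln ((\<kappa> + 1) / \<kappa>) \<le> ln 2 + ln (1 / \<kappa>)"
  proof -
    have "ln ((\<kappa> + 1) / \<kappa>) \<le> ln (2 * (1 / \<kappa>))" using k by (simp add: divide_right_mono)
    then show ?thesis using k by (subst (asm) ln_mult) auto
  qed
  have b: "- ln (\<kappa>\<^sup>2 / (\<kappa>\<^sup>2 + 1)) \<le> ln 2 + 2 * ln (1 / \<kappa>)"
  proof -
    have k2: "\<kappa>\<^sup>2 \<le> 1" using k by (simp add: power_le_one)
    have "- ln (\<kappa>\<^sup>2 / (\<kappa>\<^sup>2 + 1)) = ln (\<kappa>\<^sup>2 + 1) - ln (\<kappa>\<^sup>2)"
      using k one_plus_sq_pos by (simp add: ln_div add.commute)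
    moreover have "ln (\<kappa>\<^sup>2 + 1) \<le> ln 2" using k2 one_plus_sq_pos by (simp add: add.commute)
    moreover have "ln (\<kappa>\<^sup>2) = - 2 * ln (1 / \<kappa>)" using k by (simp add: ln_realpow ln_div)
    ultimately show ?thesis by simp
  qed
  have c: "\<kappa> * (1 + \<kappa>\<^sup>2) / (1 + \<kappa> + \<kappa>\<^sup>2) \<le> \<kappa>"
    using k one_plus_sq_pos by (simp add: pos_divide_le_eq add_pos_nonneg algebra_simps)
  have bn: "0 \<le> - ln (\<kappa>\<^sup>2 / (\<kappa>\<^sup>2 + 1))" using k one_plus_sq_pos by (simp add: ln_div add.commute)
  have an: "0 \<le> ln ((\<kappa> + 1) / \<kappa>)" using k by simp
  have "depth \<kappa> 1 = \<kappa> * (1 + \<kappa>\<^sup>2) / (1 + \<kappa> + \<kappa>\<^sup>2) * (ln ((\<kappa> + 1) / \<kappa>) + - ln (\<kappa>\<^sup>2 / (\<kappa>\<^sup>2 + 1)))"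
    by (simp add: depth_def)
  also have "\<dots> \<le> \<kappa> * (2 + 3 * ln (1 / \<kappa>))"
    by (intro mult_mono c) (use a b l2 an bn k in linarith)+
  finally show ?thesis .
qed

lemma height_nonpos: "h \<le> 0 \<Longrightarrow> height \<kappa> h = h"
  by (simp add: height_def clamp01_simps depth_0)

lemma height_mid: "0 \<le> h \<Longrightarrow> h \<le> 1 \<Longrightarrow> height \<kappa> h = depth \<kappa> h"
  by (simp add: height_def clamp01_simps)

lemma height_ge1: "1 \<le> h \<Longrightarrow> height \<kappa> h = depth \<kappa> 1 + (h - 1) / end_scale \<kappa>"
  by (simp add: height_def clamp01_simps)

lemma height_strict_mono:
  assumes "h < h'"
  shows "height \<kappa> h < height \<kappa> h'"
proof -
  have nn: "depth \<kappa> (clamp01 h) \<le> depth \<kappa> (clamp01 h')"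
  proof (cases "clamp01 h = clamp01 h'")
    case False
    moreover have "clamp01 h \<le> clamp01 h'" using assms by (auto simp: clamp01_def)
    ultimately show ?thesis
      using depth_strict_mono[of "clamp01 h" "clamp01 h'"] clamp01_simps(4,5) by force
  qed simp
  have m: "max (h - 1) 0 / end_scale \<kappa> \<le> max (h' - 1) 0 / end_scale \<kappa>"
    using end_scale_pos assms by (intro divide_right_mono) auto
  consider "h < 0" | "0 \<le> h" "h < 1" | "1 \<le> h" by linarith
  then show ?thesis
  proof cases
    case 1 then show ?thesis using nn m assms unfolding height_def by linarith
  next
    case 2
    then have "depth \<kappa> (clamp01 h) < depth \<kappa> (clamp01 h')"
      using assms by (intro depth_strict_mono) (auto simp: clamp01_def)
    then show ?thesis using m assms unfolding height_def by linarith
  next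
    case 3
    then show ?thesis using assms end_scale_pos by (simp add: height_ge1 divide_strict_right_mono)
  qed
qed

lemma height_less_iff: "height \<kappa> h < height \<kappa> h' \<longleftrightarrow> h < h'"
  using height_strict_mono[of h h'] height_strict_mono[of h' h] by (cases h h' rule: linorder_cases) auto

lemma height_inj: "height \<kappa> h = height \<kappa> h' \<Longrightarrow> h = h'"
  using height_strict_mono[of h h'] height_strict_mono[of h' h] by (cases h h' rule: linorder_cases) auto

lemma height_continuous: "continuous_on UNIV (height \<kappa>)"
  unfolding height_def[abs_def]
  by (intro continuous_intros continuous_on_compose2[OF depth_continuous continuous_clamp01])
     (use end_scale_pos clamp01_simps in auto)

lemma height_surj: "\<exists>h. height \<kappa> h = v"
proof -
  consider "v \<le> 0" | "0 \<le> v" "v \<le> depth \<kappa> 1" | "depth \<kappa> 1 \<le> v" by linarith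
  then show ?thesis
  proof cases
    case 1 then show ?thesis using height_nonpos by blast
  next
    case 2
    then obtain h where "0 \<le> h" "h \<le> 1" "depth \<kappa> h = v"
      using IVT'[of "depth \<kappa>" 0 v 1] depth_continuous depth_0 by auto
    then show ?thesis using height_mid by blast
  next
    case 3
    then have "1 \<le> 1 + (v - depth \<kappa> 1) * end_scale \<kappa>" using end_scale_pos by simp
    then have "height \<kappa> (1 + (v - depth \<kappa> 1) * end_scale \<kappa>) = v" using end_scale_pos by (simp add: height_ge1)
    then show ?thesis by blast
  qed
qed

lemma lipschitz_height: "\<exists>L. L-lipschitz_on UNIV (height \<kappa>)"
proof -
  have "\<exists>L. L-lipschitz_on {0..1} (depth \<kappa>)"
  proof (rule lipschitz_vector_derivative)
    show "(depth \<kappa> has_vector_derivative 1 / profile \<kappa> x) (at x within {0..1})" if "x \<in> {0..1}" for x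
      using depth_deriv that by (auto simp: has_real_derivative_iff_has_vector_derivative)
    show "continuous_on {0..1} (\<lambda>x. 1 / profile \<kappa> x)"
      using profile_pos k one_plus_sq_pos
      by (intro continuous_intros DERIV_continuous_on[OF profile_deriv]) (auto simp: less_imp_neq[symmetric])
  qed
  then obtain L where L: "L-lipschitz_on UNIV (\<lambda>h. depth \<kappa> (clamp01 h))"
    using lipschitz_comp_clamp01 by blast
  have "1-lipschitz_on UNIV (\<lambda>h::real. min h 0)" "1-lipschitz_on UNIV (\<lambda>h::real. max (h - 1) 0)"
    by (auto simp: lipschitz_on_def dist_real_def)
  from lipschitz_on_add[OF lipschitz_on_add[OF this(1) L] lipschitz_on_cmult[OF this(2), of "1 / end_scale \<kappa>"]]
  show ?thesis unfolding height_def[abs_def] by auto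
qed

end

section \<open>The domains and the homeomorphism\<close>

text \<open>Uniqueness of the expansion in base m: two different corridors have grid points that
  differ in some coordinate. The induction strips the lowest digit.\<close>

lemma digits_inject:
  fixes m :: nat
  assumes "i < m ^ q" "j < m ^ q" "\<And>d. d < q \<Longrightarrow> (i div m ^ d) mod m = (j div m ^ d) mod m"
  shows "i = j"
  using assms
proof (induction q arbitrary: i j)
  case (Suc q)
  have m: "m > 0" using Suc.prems(1) by (cases m) auto
  have "i div m = j div m"
  proof (rule Suc.IH)
    show "i div m < m ^ q" "j div m < m ^ q"
      using Suc.prems(1,2) by (auto intro: less_mult_imp_div_less simp: mult.commute)
    show "(i div m) div m ^ d mod m = (j div m) div m ^ d mod m" if "d < q" for d
      using Suc.prems(3)[of "Suc d"] that by (simp add: div_mult2_eq)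
  qed
  moreover have "i mod m = j mod m" using Suc.prems(3)[of 0] by simp
  ultimately show ?case by (metis div_mult_mod_eq)
qed simp

text \<open>The numbering r of the coordinates is arbitrary; it assigns digit positions to the axes
  of an index type that carries no order.\<close>

locale corridors =
  fixes r :: "'n::finite \<Rightarrow> nat"
  assumes r_bij: "bij_betw r UNIV {..<CARD('n)}" and card3: "3 \<le> CARD('n)"
begin

definition axis_at :: "nat \<Rightarrow> 'n" where "axis_at q = inv r q"

lemma r_axis_at: "q < CARD('n) \<Longrightarrow> r (axis_at q) = q"
  unfolding axis_at_def using r_bij by (metis bij_betw_def f_inv_into_f lessThan_iff)

text \<open>The last number is spent on \<open>vert\<close>, so that the horizontal axes carry the
  digit positions 0 to n - 2, with the leading one at \<open>lin\<close>. Along \<open>off\<close>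
  the constructions for different k are kept apart; dimension at least 3 makes it different from
  \<open>lin\<close>.\<close>

definition vert :: 'n where "vert = axis_at (CARD('n) - 1)"
definition lin :: 'n where "lin = axis_at (CARD('n) - 2)"
definition off :: 'n where "off = axis_at 0"

lemma r_simps: "r vert = CARD('n) - 1" "r lin = CARD('n) - 2" "r off = 0"
  using card3 by (auto simp: vert_def lin_def off_def r_axis_at)

lemma distinct_axes [simp]: "vert \<noteq> lin" "lin \<noteq> vert" "vert \<noteq> off" "off \<noteq> vert" "lin \<noteq> off" "off \<noteq> lin"
  using r_simps card3 by auto

text \<open>\<open>radix\<close> grows faster than any power of \<open>1 / spread\<close>, so that \<open>spread\<close> and the logarithm in
  \<open>depth\<close> only cost an arbitrarily small power of \<open>gap\<close>.\<close>

definition radix :: "nat \<Rightarrow> nat" where "radix k = 4 ^ ((k + 1)\<^sup>2)"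
definition corridor_count :: "nat \<Rightarrow> nat" where "corridor_count k = radix k ^ (CARD('n) - 1)"
definition gap :: "nat \<Rightarrow> real" where "gap k = 1 / real (corridor_count k)"
definition spread :: "nat \<Rightarrow> real" where "spread k = 1 / 4 ^ (k + 1)"
text \<open>Chosen so that \<open>width / gap\<close> is a quarter of the grid spacing
  \<open>spread / radix\<close>: in the source a tube has radius \<open>width * profile\<close>,
  whose parabolic part is at most \<open>z * (1 - z) * width / gap\<close>.\<close>

definition width :: "nat \<Rightarrow> real" where "width k = gap k * spread k / (4 * real (radix k))"

definition base :: "nat \<Rightarrow> real^'n" where "base k = axis off (2 * spread k)"
definition lin_pos :: "nat \<Rightarrow> nat \<Rightarrow> real^'n" where "lin_pos k i = axis lin (real i * gap k)"

text \<open>The digits of \<open>i\<close> in base \<open>radix k\<close> are the coordinates of a grid point. The leading digit is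
  in direction \<open>lin\<close>, where it is monotone in \<open>i\<close>; hence interpolating between \<open>lin_pos\<close> and
  \<open>grid_pos\<close> never brings two points together.\<close>

definition grid_pos :: "nat \<Rightarrow> nat \<Rightarrow> real^'n" where
  "grid_pos k i = (\<chi> j. if j = vert then 0 else spread k * real ((i div radix k ^ r j) mod radix k) / real (radix k))"
definition up :: "real^'n" where "up = axis vert 1"
definition mouth :: "nat \<Rightarrow> nat \<Rightarrow> real^'n" where "mouth k i = base k + lin_pos k i"

text \<open>The parabola switches the grid displacement off at both ends. The axis starts at the
  mouth and ends at the point of the segment whose distance from \<open>base\<close> is contracted
  by \<open>end_scale\<close>.\<close>

definition tube_axis :: "nat \<Rightarrow> nat \<Rightarrow> real \<Rightarrow> real^'n" where
  "tube_axis k i z = base k + shrink (gap k) z *\<^sub>R lin_pos k i + (z * (1 - z)) *\<^sub>R grid_pos k i"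

text \<open>Cross sections are scaled by \<open>1 / profile\<close>, which is also the derivative of \<open>height\<close>; the
  differential is therefore a multiple of a shear. The map is the identity for nonpositive heights
  and a similarity independent of \<open>i\<close> for heights above 1.\<close>

definition piece_map :: "nat \<Rightarrow> nat \<Rightarrow> real^'n \<Rightarrow> real^'n" where
  "piece_map k i x = mouth k i +
     (1 / profile (gap k) (clamp01 (x $ vert))) *\<^sub>R (x - (x $ vert) *\<^sub>R up - tube_axis k i (clamp01 (x $ vert)))
     + height (gap k) (x $ vert) *\<^sub>R up"

text \<open>The body has half side 2 and its top face lies at height 0. The mouths have horizontal
  coordinates in [0, 1], hence lie in this face, away from its edges.\<close>

definition center :: "real^'n" where "center = vec 1 - 3 *\<^sub>R up"
definition body :: "(real^'n) set" where "body = box (center - vec 2) (center + vec 2)"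
definition corridor :: "nat \<Rightarrow> nat \<Rightarrow> (real^'n) set" where
  "corridor k i = box (mouth k i - vec (width k)) (mouth k i + (depth (gap k) 1 + width k) *\<^sub>R up + vec (width k))"
definition tunnel :: "nat \<Rightarrow> (real^'n) set" where
  "tunnel k = box (base k + (depth (gap k) 1 + width k) *\<^sub>R up - vec (width k))
     (base k + (depth (gap k) 1 + width k) *\<^sub>R up + axis lin 1 + vec (width k))"
definition target_piece :: "nat \<Rightarrow> nat \<Rightarrow> (real^'n) set" where
  "target_piece k i = body \<union> corridor k i \<union> tunnel k"
text \<open>As a preimage under a continuous bijection of the whole space, it is open and is mapped
  onto \<open>target_piece\<close> without any explicit description of its shape.\<close>

definition source_piece :: "nat \<Rightarrow> nat \<Rightarrow> (real^'n) set" where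
  "source_piece k i = piece_map k i -` target_piece k i"
definition target :: "(real^'n) set" where "target = (\<Union>k. \<Union>i<corridor_count k. target_piece k i)"
definition source :: "(real^'n) set" where "source = (\<Union>k. \<Union>i<corridor_count k. source_piece k i)"

text \<open>The choice is irrelevant by \<open>piece_map_agree\<close> below.\<close>

definition glued :: "real^'n \<Rightarrow> real^'n" where
  "glued x =
    (let ki = SOME ki. snd ki < corridor_count (fst ki) \<and> x \<in> source_piece (fst ki) (snd ki)
     in piece_map (fst ki) (snd ki) x)"

section \<open>Relations between the parameters\<close>

lemma radix_ge: "4 \<le> radix k" "0 < radix k"
proof -
  have "(4::nat) ^ 1 \<le> 4 ^ ((k + 1)\<^sup>2)" by (intro power_increasing) auto
  then show "4 \<le> radix k" by (simp add: radix_def)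
  then show "0 < radix k" by simp
qed

lemma corridor_count_ge: "16 \<le> corridor_count k" "0 < corridor_count k"
proof -
  have "(4::nat)\<^sup>2 \<le> radix k ^ 2" using radix_ge by (intro power_mono) auto
  also have "\<dots> \<le> radix k ^ (CARD('n) - 1)" using radix_ge[of k] card3 by (intro power_increasing) auto
  finally show "16 \<le> corridor_count k" by (simp add: corridor_count_def)
  then show "0 < corridor_count k" by simp
qed

lemma gap_bounds: "0 < gap k" "gap k \<le> 1/16"
  using corridor_count_ge[of k] by (auto simp: gap_def field_simps)

lemma gap_le_quarter: "0 < gap k" "gap k \<le> 1/4" using gap_bounds[of k] by auto

lemma spread_bounds: "0 < spread k" "spread k \<le> 1/4"
proof -
  have "(4::real) ^ 1 \<le> 4 ^ (k + 1)" by (intro power_increasing) auto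
  then show "spread k \<le> 1/4" by (simp add: spread_def field_simps)
qed (simp add: spread_def)

lemma width_pos: "0 < width k" using gap_bounds spread_bounds radix_ge by (simp add: width_def)

lemma width_div: "width k / gap k = spread k / (4 * real (radix k))"
  using gap_bounds[of k] by (simp add: width_def)

lemma spread_div_radix: "spread k / (4 * real (radix k)) \<le> spread k / 16"
  using radix_ge[of k] spread_bounds[of k] by (intro divide_left_mono) auto

lemma width_le_spread: "width k \<le> spread k / 256"
proof -
  have "width k = gap k * (spread k / (4 * real (radix k)))" by (simp add: width_def)
  also have "\<dots> \<le> (1/16) * (spread k / 16)"
    using gap_bounds[of k] spread_div_radix[of k] spread_bounds[of k] by (intro mult_mono) auto
  finally show ?thesis by simp
qed

lemma width_le_gap: "width k \<le> gap k / 64"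
proof -
  have "width k = gap k * (spread k / (4 * real (radix k)))" by (simp add: width_def)
  also have "\<dots> \<le> gap k * (1/64)"
    using gap_bounds[of k] spread_div_radix[of k] spread_bounds[of k] by (intro mult_left_mono) auto
  finally show ?thesis by simp
qed

text \<open>Since \<open>spread\<close> drops by a factor 4 from one k to the next, these intervals
  are disjoint. Above height 0 the coordinate \<open>off\<close> lies in them, in the source as in
  the target, and so determines k.\<close>

lemma spread_unique:
  assumes "spread k < X" "X < 3 * spread k" "spread l < X" "X < 3 * spread l"
  shows "k = l"
proof -
  have aux: "3 * spread b < spread a" if "a < b" for a b
  proof -
    have "(4::real) ^ (a + 2) \<le> 4 ^ (b + 1)" using that by (intro power_increasing) auto
    then have "spread b \<le> spread a / 4" by (simp add: spread_def field_simps)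
    then show ?thesis using spread_bounds(1)[of a] by linarith
  qed
  show ?thesis using aux[of k l] aux[of l k] assms by (cases k l rule: linorder_cases) auto
qed

lemma width_profile_le:
  assumes z: "0 \<le> z" "z \<le> 1"
  shows "width k * profile (gap k) z \<le> width k * shrink (gap k) z + z * (1 - z) * (spread k / (4 * real (radix k)))"
proof -
  have "width k * profile (gap k) z \<le> width k * (shrink (gap k) z + z * (1 - z) / gap k)"
    using width_pos[of k] by (intro mult_left_mono profile_le gap_le_quarter z) auto
  also have "\<dots> = width k * shrink (gap k) z + z * (1 - z) * (width k / gap k)"
    by (simp add: algebra_simps)
  finally show ?thesis unfolding width_div .
qed

lemma width_profile_le_spread:
  assumes z: "0 \<le> z" "z \<le> 1"
  shows "width k * profile (gap k) z \<le> spread k / 4"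
proof -
  have "width k * shrink (gap k) z \<le> width k"
    using width_pos[of k] shrink_bounds(2)[OF gap_le_quarter z] by simp
  moreover have "z * (1 - z) * (spread k / (4 * real (radix k))) \<le> (1/4) * (spread k / 16)"
    using parabola_bounds[OF z] spread_div_radix[of k] spread_bounds[of k] by (intro mult_mono) auto
  ultimately show ?thesis using width_profile_le[OF z, of k] width_le_spread[of k] spread_bounds[of k] by linarith
qed

section \<open>Coordinates of the maps and membership in the pieces\<close>

lemma component_simps [simp]:
  "base k $ vert = 0" "lin_pos k i $ vert = 0" "grid_pos k i $ vert = 0" "mouth k i $ vert = 0"
  "tube_axis k i z $ vert = 0"
  "up $ vert = 1" "j \<noteq> vert \<Longrightarrow> up $ j = 0" "base k $ off = 2 * spread k" "lin_pos k i $ off = 0"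
  "base k $ lin = 0" "lin_pos k i $ lin = real i * gap k"
  "j \<noteq> lin \<Longrightarrow> lin_pos k i $ j = 0" "j \<noteq> off \<Longrightarrow> base k $ j = 0"
  by (auto simp: base_def lin_pos_def grid_pos_def mouth_def tube_axis_def up_def axis_def)

lemma mouth_lin [simp]: "mouth k i $ lin = real i * gap k"
  by (simp add: mouth_def)

lemma mouth_other [simp]: "j \<noteq> lin \<Longrightarrow> mouth k i $ j = base k $ j"
  by (simp add: mouth_def)

lemma piece_map_vert [simp]: "piece_map k i x $ vert = height (gap k) (x $ vert)"
  by (simp add: piece_map_def)

lemma piece_map_other: "j \<noteq> vert \<Longrightarrow> piece_map k i x $ j =
    mouth k i $ j + (x $ j - tube_axis k i (clamp01 (x $ vert)) $ j) / profile (gap k) (clamp01 (x $ vert))"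
  by (simp add: piece_map_def)

lemma profile_clamp_pos: "0 < profile (gap k) (clamp01 h)"
  by (intro profile_pos gap_le_quarter clamp01_simps)

lemma piece_map_nonpos: "x $ vert \<le> 0 \<Longrightarrow> piece_map k i x = x"
  by (simp add: piece_map_def clamp01_simps profile_0[OF gap_le_quarter] height_nonpos[OF gap_le_quarter]
      tube_axis_def mouth_def shrink_def)

lemma tube_axis_1: "tube_axis k i 1 = base k + end_scale (gap k) *\<^sub>R lin_pos k i"
  by (simp add: tube_axis_def shrink_def)

lemma piece_map_ge1:
  assumes "1 \<le> x $ vert"
  shows "piece_map k i x = base k + (1 / end_scale (gap k)) *\<^sub>R (x - (x $ vert) *\<^sub>R up - base k)
     + (depth (gap k) 1 + (x $ vert - 1) / end_scale (gap k)) *\<^sub>R up"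
  using assms end_scale_pos[OF gap_le_quarter[of k]]
  by (simp add: piece_map_def clamp01_simps height_ge1[OF gap_le_quarter] tube_axis_1 mouth_def end_scale_def[symmetric] algebra_simps)

lemma piece_map_inj: "piece_map k i x = piece_map k i y \<Longrightarrow> x = y"
proof -
  assume eq: "piece_map k i x = piece_map k i y"
  have v: "x $ vert = y $ vert"
    using arg_cong[OF eq, of "\<lambda>v. v $ vert"] height_inj[OF gap_le_quarter] by simp
  have "x $ j = y $ j" for j
  proof (cases "j = vert")
    case False
    show ?thesis
      using arg_cong[OF eq, of "\<lambda>v. v $ j"] profile_clamp_pos[of k "x $ vert"] v
      by (simp add: piece_map_other[OF False])
  qed (use v in simp)
  then show "x = y" by (simp add: vec_eq_iff)
qed

lemma piece_map_surj: "\<exists>x. piece_map k i x = v"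
proof -
  obtain h where h: "height (gap k) h = v $ vert" using height_surj[OF gap_le_quarter] by blast
  define x where "x = h *\<^sub>R up + tube_axis k i (clamp01 h) + profile (gap k) (clamp01 h) *\<^sub>R (v - (v $ vert) *\<^sub>R up - mouth k i)"
  have [simp]: "x $ vert = h" by (simp add: x_def)
  have "piece_map k i x = v"
    using profile_clamp_pos[of k h] by (simp add: piece_map_def h) (simp add: x_def)
  then show ?thesis by blast
qed

lemma continuous_piece_map: "continuous_on UNIV (piece_map k i)"
proof -
  have c: "continuous_on UNIV (\<lambda>x::real^'n. clamp01 (x $ vert))"
    by (intro continuous_on_compose2[OF continuous_clamp01] continuous_intros) auto
  have p: "continuous_on UNIV (profile (gap k))"
    by (rule DERIV_continuous_on[OF profile_deriv[OF gap_le_quarter]])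
  have pc: "continuous_on UNIV (\<lambda>x::real^'n. profile (gap k) (clamp01 (x $ vert)))"
    by (intro continuous_on_compose2[OF p c]) auto
  have hc: "continuous_on UNIV (\<lambda>x::real^'n. height (gap k) (x $ vert))"
    by (intro continuous_on_compose2[OF height_continuous[OF gap_le_quarter]] continuous_intros) auto
  show ?thesis unfolding piece_map_def[abs_def] tube_axis_def shrink_def
    using profile_clamp_pos by (intro continuous_intros c pc hc) (auto simp: less_imp_neq[symmetric])
qed

lemma mem_body: "x \<in> body \<longleftrightarrow> -4 < x $ vert \<and> x $ vert < 0 \<and> (\<forall>j. j \<noteq> vert \<longrightarrow> -1 < x $ j \<and> x $ j < 3)"
proof -
  have "x \<in> body \<longleftrightarrow> (\<forall>j. center $ j - 2 < x $ j \<and> x $ j < center $ j + 2)"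
    by (simp add: body_def mem_box_cart)
  moreover have "center $ j = (if j = vert then -2 else 1)" for j by (auto simp: center_def)
  ultimately show ?thesis by force
qed

lemma mem_corridor: "x \<in> corridor k i \<longleftrightarrow> - width k < x $ vert \<and> x $ vert < depth (gap k) 1 + 2 * width k \<and>
    (\<forall>j. j \<noteq> vert \<longrightarrow> \<bar>x $ j - mouth k i $ j\<bar> < width k)"
proof -
  define a where "a j = (mouth k i - vec (width k)) $ j" for j
  define b where "b j = (mouth k i + (depth (gap k) 1 + width k) *\<^sub>R up + vec (width k)) $ j" for j
  have vals: "a vert = - width k" "b vert = depth (gap k) 1 + 2 * width k"
    "\<And>j. j \<noteq> vert \<Longrightarrow> a j = mouth k i $ j - width k"
    "\<And>j. j \<noteq> vert \<Longrightarrow> b j = mouth k i $ j + width k"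
    by (auto simp: a_def b_def simp del: mouth_other)
  have "x \<in> corridor k i \<longleftrightarrow> (\<forall>j. a j < x $ j \<and> x $ j < b j)"
    by (simp add: corridor_def mem_box_cart a_def b_def)
  also have "\<dots> \<longleftrightarrow> (a vert < x $ vert \<and> x $ vert < b vert) \<and>
     (\<forall>j. j \<noteq> vert \<longrightarrow> a j < x $ j \<and> x $ j < b j)" by metis
  also have "\<dots> \<longleftrightarrow> - width k < x $ vert \<and> x $ vert < depth (gap k) 1 + 2 * width k \<and>
    (\<forall>j. j \<noteq> vert \<longrightarrow> \<bar>x $ j - mouth k i $ j\<bar> < width k)"
    unfolding abs_less_iff using vals by (force simp del: mouth_other)
  finally show ?thesis .
qed

lemma mem_tunnel: "x \<in> tunnel k \<longleftrightarrow> depth (gap k) 1 < x $ vert \<and> x $ vert < depth (gap k) 1 + 2 * width k \<and>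
    - width k < x $ lin \<and> x $ lin < 1 + width k \<and>
    (\<forall>j. j \<noteq> vert \<and> j \<noteq> lin \<longrightarrow> \<bar>x $ j - base k $ j\<bar> < width k)"
  (is "_ \<longleftrightarrow> ?R")
proof -
  define a where "a j = (base k + (depth (gap k) 1 + width k) *\<^sub>R up - vec (width k)) $ j" for j
  define b where "b j = (base k + (depth (gap k) 1 + width k) *\<^sub>R up + axis lin 1 + vec (width k)) $ j" for j
  have vals: "a vert = depth (gap k) 1" "b vert = depth (gap k) 1 + 2 * width k" "a lin = - width k" "b lin = 1 + width k"
    "\<And>j. j \<noteq> vert \<Longrightarrow> j \<noteq> lin \<Longrightarrow> a j = base k $ j - width k"
    "\<And>j. j \<noteq> vert \<Longrightarrow> j \<noteq> lin \<Longrightarrow> b j = base k $ j + width k"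
    by (auto simp: a_def b_def axis_def)
  have "x \<in> tunnel k \<longleftrightarrow> (\<forall>j. a j < x $ j \<and> x $ j < b j)"
    by (simp add: tunnel_def mem_box_cart a_def b_def)
  also have "\<dots> \<longleftrightarrow> (a vert < x $ vert \<and> x $ vert < b vert) \<and> (a lin < x $ lin \<and> x $ lin < b lin) \<and>
     (\<forall>j. j \<noteq> vert \<and> j \<noteq> lin \<longrightarrow> a j < x $ j \<and> x $ j < b j)" by metis
  also have "\<dots> \<longleftrightarrow> ?R" using vals by (auto simp: abs_less_iff)
  finally show ?thesis .
qed

lemma target_piece_above:
  assumes "v \<in> target_piece k i" "0 < v $ vert"
  shows "v \<in> corridor k i \<or> v \<in> tunnel k" "\<bar>v $ off - 2 * spread k\<bar> < width k"
proof -
  show "v \<in> corridor k i \<or> v \<in> tunnel k" using assms by (auto simp: target_piece_def mem_body)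
  then show "\<bar>v $ off - 2 * spread k\<bar> < width k"
    by (auto simp: mem_corridor mem_tunnel dest!: spec[of _ off])
qed

lemma target_piece_above_off:
  assumes "v \<in> target_piece k i" "0 < v $ vert"
  shows "spread k < v $ off" "v $ off < 3 * spread k"
  using target_piece_above(2)[OF assms] width_le_spread[of k] spread_bounds[of k] by linarith+

section \<open>Disjointness of the tubes and compatibility of the pieces\<close>

lemma grid_pos_bounds: "0 \<le> grid_pos k i $ j" "grid_pos k i $ j \<le> spread k"
proof -
  have "real ((i div radix k ^ r j) mod radix k) / real (radix k) \<le> 1"
    using radix_ge[of k] by (simp add: less_imp_le)
  then have "spread k * (real ((i div radix k ^ r j) mod radix k) / real (radix k)) \<le> spread k"
    using spread_bounds[of k] by (intro mult_left_le) auto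
  then show "grid_pos k i $ j \<le> spread k" using spread_bounds[of k] by (simp add: grid_pos_def)
  show "0 \<le> grid_pos k i $ j" using spread_bounds[of k] by (simp add: grid_pos_def)
qed

lemma height_pos_iff: "0 < height (gap k) h \<longleftrightarrow> 0 < h"
  using height_less_iff[OF gap_le_quarter, of k 0 h] height_nonpos[OF gap_le_quarter, of 0] by simp

lemma height_1: "height (gap k) 1 = depth (gap k) 1"
  by (simp add: height_mid[OF gap_le_quarter])

text \<open>Around \<open>2 * spread\<close> the grid displacement adds between 0 and
  \<open>spread / 4\<close>, and the tube radius is at most \<open>spread / 4\<close>. Heights above
  1 are included, with \<open>clamp01\<close> equal to 1.\<close>

lemma source_piece_above_off:
  assumes "x \<in> source_piece k i" "0 < x $ vert"
  shows "spread k < x $ off" "x $ off < 3 * spread k"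
proof -
  define z where "z = clamp01 (x $ vert)"
  have z: "0 \<le> z" "z \<le> 1" using clamp01_simps by (auto simp: z_def)
  have "\<bar>piece_map k i x $ off - 2 * spread k\<bar> < width k"
    using assms by (intro target_piece_above) (auto simp: source_piece_def height_pos_iff)
  then have "\<bar>(x $ off - tube_axis k i z $ off) / profile (gap k) z\<bar> < width k"
    by (simp add: piece_map_other z_def)
  then have "\<bar>x $ off - tube_axis k i z $ off\<bar> < width k * profile (gap k) z"
    using profile_pos[OF gap_le_quarter z, of k] by (simp add: pos_divide_less_eq abs_divide)
  then have 1: "\<bar>x $ off - tube_axis k i z $ off\<bar> < spread k / 4" using width_profile_le_spread[OF z, of k] by linarith
  have 2: "tube_axis k i z $ off = 2 * spread k + z * (1 - z) * grid_pos k i $ off"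
    by (simp add: tube_axis_def)
  have "z * (1 - z) * grid_pos k i $ off \<le> (1/4) * spread k"
    using parabola_bounds[OF z] grid_pos_bounds[of k i off] spread_bounds[of k] by (intro mult_mono) auto
  moreover have "0 \<le> z * (1 - z) * grid_pos k i $ off"
    using z grid_pos_bounds[of k i off] by (intro mult_nonneg_nonneg) auto
  ultimately show "spread k < x $ off" "x $ off < 3 * spread k"
    using 1 spread_bounds[of k] unfolding 2 by linarith+
qed

text \<open>Heights below 1 are mapped below the floor of the tunnel. Only the corridor remains, and
  its half width pulls back to the tube radius \<open>width * profile\<close>.\<close>

lemma source_piece_mid:
  assumes "x \<in> source_piece k i" "0 < x $ vert" "x $ vert < 1" "j \<noteq> vert"
  shows "\<bar>x $ j - tube_axis k i (x $ vert) $ j\<bar> < width k * profile (gap k) (x $ vert)"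
proof -
  have "piece_map k i x \<notin> tunnel k"
    using height_strict_mono[OF gap_le_quarter assms(3), of k] by (simp add: mem_tunnel height_1)
  moreover have "piece_map k i x \<in> corridor k i \<or> piece_map k i x \<in> tunnel k"
    using assms by (intro target_piece_above) (auto simp: source_piece_def height_pos_iff)
  ultimately have "\<bar>piece_map k i x $ j - mouth k i $ j\<bar> < width k" using assms(4) by (simp add: mem_corridor)
  then show ?thesis
    using assms profile_pos[OF gap_le_quarter, of "x $ vert" k]
    by (simp add: piece_map_other clamp01_simps pos_divide_less_eq)
qed

text \<open>Two axes are at distance at least \<open>shrink * gap\<close> (in direction \<open>lin\<close>) and at least
  \<open>z (1 - z) spread / radix\<close> (from a differing digit); four times the tube radius
  \<open>width * profile\<close> is at most the sum of the two.\<close>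

lemma tube_axis_separated:
  assumes ij: "i < j" "j < corridor_count k" and z: "0 \<le> z" "z \<le> 1"
    and close: "\<And>a. a \<noteq> vert \<Longrightarrow> \<bar>tube_axis k i z $ a - tube_axis k j z $ a\<bar> < 2 * (width k * profile (gap k) z)"
  shows False
proof -
  let ?\<alpha> = "shrink (gap k) z" and ?\<beta> = "z * (1 - z)" and ?m = "real (radix k)"
  define dig where "dig i d = (i div radix k ^ d) mod radix k" for i d
  define top where "top i = dig i (CARD('n) - 2)" for i
  have a0: "0 < ?\<alpha>" using shrink_bounds[OF gap_le_quarter z] by simp
  have b0: "0 \<le> ?\<beta>" using parabola_bounds[OF z] by simp
  have mid: "width k * profile (gap k) z * 4 \<le> ?\<alpha> * gap k + ?\<beta> * (spread k / ?m)"
  proof -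
    have "width k * ?\<alpha> \<le> gap k / 4 * ?\<alpha>"
      using a0 width_le_gap[of k] gap_bounds[of k] by (intro mult_right_mono) auto
    moreover have "?\<beta> * (spread k / (4 * ?m)) = ?\<beta> * (spread k / ?m) / 4" by simp
    moreover have "gap k / 4 * ?\<alpha> = ?\<alpha> * gap k / 4" by simp
    moreover have "A * 4 \<le> D + E" if "A \<le> B + C" "B \<le> D / 4" "C = E / 4" for A B C D E :: real
      using that by linarith
    ultimately show ?thesis using width_profile_le[OF z, of k] by metis
  qed
  have corridor_count_eq: "corridor_count k = radix k ^ (CARD('n) - 2) * radix k"
    using card3 by (simp add: corridor_count_def power_Suc2[symmetric] Suc_diff_Suc numeral_2_eq_2 del: power_Suc)
  have top_eq: "top a = a div radix k ^ (CARD('n) - 2)" if "a < corridor_count k" for a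
    using that radix_ge[of k] unfolding top_def dig_def corridor_count_eq
    by (intro mod_less less_mult_imp_div_less) (simp add: mult.commute)
  have top_mono: "top i \<le> top j"
    using ij by (simp add: top_eq div_le_mono)
  have tube_axis_lin: "tube_axis k a z $ lin = ?\<alpha> * (real a * gap k) + ?\<beta> * (spread k * real (top a) / ?m)" for a
    by (simp add: tube_axis_def grid_pos_def top_def dig_def r_simps)
  have tube_axis_oth: "tube_axis k a z $ b = base k $ b + ?\<beta> * (spread k * real (dig a (r b)) / ?m)" if "b \<noteq> vert" "b \<noteq> lin" for a b
    using that by (simp add: tube_axis_def grid_pos_def dig_def)
  have step: "?\<alpha> * gap k + ?\<beta> * (spread k * (real (top j) - real (top i)) / ?m) < 2 * (width k * profile (gap k) z)"
  proof -
    have "?\<alpha> * gap k \<le> ?\<alpha> * ((real j - real i) * gap k)"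
      using a0 ij gap_bounds[of k] by (intro mult_left_mono) auto
    moreover have "tube_axis k j z $ lin - tube_axis k i z $ lin =
       ?\<alpha> * ((real j - real i) * gap k) + ?\<beta> * (spread k * (real (top j) - real (top i)) / ?m)"
      unfolding tube_axis_lin by (simp add: algebra_simps diff_divide_distrib)
    moreover have "A + C < D" if "A \<le> B" "Y - X = B + C" "\<bar>X - Y\<bar> < D" for A B C D X Y :: real
      using that by linarith
    ultimately show ?thesis using close[OF distinct_axes(2)] by metis
  qed
  have "?\<beta> * (spread k / ?m) < 2 * (width k * profile (gap k) z) \<and> ?\<alpha> * gap k < 2 * (width k * profile (gap k) z)"
  \<comment> \<open>If the leading digits differ, both summands of the difference along
    \<open>lin\<close> have the same sign, so this one coordinate yields both inequalities.\<close>
  proof (cases "top i < top j")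
    case True
    then have "1 \<le> real (top j) - real (top i)" by simp
    then have "?\<beta> * (spread k * 1 / ?m) \<le> ?\<beta> * (spread k * (real (top j) - real (top i)) / ?m)"
      using b0 spread_bounds[of k] by (intro mult_left_mono divide_right_mono) auto
    moreover have "0 \<le> ?\<beta> * (spread k * 1 / ?m)" "0 \<le> ?\<alpha> * gap k"
      using b0 spread_bounds[of k] a0 gap_bounds[of k] by auto
    ultimately show ?thesis using step unfolding mult_1_right by linarith
  next
    case False
    then have te: "top i = top j" using top_mono by simp
    \<comment> \<open>With equal leading digits the difference sits in a lower digit, whose axis is
      free of \<open>lin_pos\<close>; there the axes differ by the grid displacement alone. The
      inequality for \<open>gap\<close> still comes from \<open>lin\<close>.\<close>
    obtain d where d: "d < CARD('n) - 1" "dig i d \<noteq> dig j d"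
      using digits_inject[of i "radix k" "CARD('n) - 1" j] ij unfolding dig_def corridor_count_def by force
    define b where "b = axis_at d"
    have rb: "r b = d" using d by (simp add: b_def r_axis_at)
    have b: "b \<noteq> vert" "b \<noteq> lin" using rb d te r_simps by (auto simp: top_def)
    have "1 \<le> \<bar>real (dig i d) - real (dig j d)\<bar>" using d(2) by linarith
    then have "?\<beta> * (spread k / ?m) * 1 \<le> ?\<beta> * (spread k / ?m) * \<bar>real (dig i d) - real (dig j d)\<bar>"
      using b0 spread_bounds[of k] by (intro mult_left_mono) auto
    also have "\<dots> = \<bar>tube_axis k i z $ b - tube_axis k j z $ b\<bar>"
    proof -
      have "tube_axis k i z $ b - tube_axis k j z $ b = ?\<beta> * (spread k / ?m) * (real (dig i d) - real (dig j d))"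
        unfolding tube_axis_oth[OF b] rb by (simp add: algebra_simps diff_divide_distrib)
      moreover have "0 \<le> ?\<beta> * (spread k / ?m)" using b0 spread_bounds[of k] by simp
      ultimately show ?thesis by (metis abs_mult abs_of_nonneg)
    qed
    also have "\<dots> < 2 * (width k * profile (gap k) z)" using close b by simp
    finally show ?thesis using step te by simp
  qed
  then show False using mid by linarith
qed

text \<open>Overlaps are harmless at all heights: up to 0 every piece is the identity; from 1 on the
  formula does not involve the index of the corridor; in between the tubes are disjoint. The
  coordinate \<open>off\<close> excludes different k.\<close>

lemma piece_map_agree:
  assumes x: "x \<in> source_piece k i" "x \<in> source_piece l j" and ij: "i < corridor_count k" "j < corridor_count l"
  shows "piece_map k i x = piece_map l j x"
proof (cases "x $ vert \<le> 0")
  case True then show ?thesis by (simp add: piece_map_nonpos)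
next
  case False
  then have "k = l" using source_piece_above_off[OF x(1)] source_piece_above_off[OF x(2)] spread_unique by auto
  show ?thesis
  proof (cases "1 \<le> x $ vert")
    case True then show ?thesis using \<open>k = l\<close> by (simp add: piece_map_ge1)
  next
    case h: False
    have "\<bar>tube_axis k i (x $ vert) $ a - tube_axis k j (x $ vert) $ a\<bar> < 2 * (width k * profile (gap k) (x $ vert))" if "a \<noteq> vert" for a
      using source_piece_mid[OF x(1) _ _ that] source_piece_mid[OF x(2) _ _ that] False h \<open>k = l\<close> by auto
    then have "i = j"
      using tube_axis_separated[of i j k "x $ vert"] tube_axis_separated[of j i k "x $ vert"] ij False h \<open>k = l\<close>
      by (cases i j rule: linorder_cases) (auto simp: abs_minus_commute)
    then show ?thesis using \<open>k = l\<close> by simp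
  qed
qed

text \<open>The counterpart of the compatibility on the target side. Between heights 0 and 1 the
  image lies in both corridors, and these are disjoint for different indices because mouths are
  \<open>gap\<close> apart and \<open>width\<close> is at most \<open>gap / 64\<close>.\<close>

lemma piece_map_eq_imp:
  assumes x: "piece_map k i x \<in> target_piece k i" "piece_map k i x \<in> target_piece l j" "piece_map k i x = piece_map l j y" and ij: "i < corridor_count k" "j < corridor_count l"
  shows "x = y"
proof (cases "piece_map k i x $ vert \<le> 0")
  case True
  then have "x $ vert \<le> 0" "y $ vert \<le> 0"
    using x(3) height_pos_iff piece_map_vert by (metis linorder_not_le)+
  then show ?thesis using x(3) by (simp add: piece_map_nonpos)
next
  case False
  then have kl: "k = l" using target_piece_above_off[OF x(1)] target_piece_above_off[OF x(2)] spread_unique by auto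
  have v: "x $ vert = y $ vert"
    using arg_cong[OF x(3), of "\<lambda>v. v $ vert"] kl height_inj[OF gap_le_quarter] by simp
  show ?thesis
  proof (cases "1 \<le> x $ vert")
    case True
    then have "piece_map l j y = piece_map k i y" using v kl by (simp add: piece_map_ge1)
    then show ?thesis using x(3) piece_map_inj by metis
  next
    case h: False
    have "piece_map k i x \<notin> tunnel k"
      using height_strict_mono[OF gap_le_quarter, of "x $ vert" 1 k] h by (simp add: mem_tunnel height_1)
    then have "piece_map k i x \<in> corridor k i" "piece_map k i x \<in> corridor k j"
      using target_piece_above(1)[OF x(1)] target_piece_above(1)[OF x(2)] False kl by auto
    then have "\<bar>piece_map k i x $ lin - mouth k i $ lin\<bar> < width k" "\<bar>piece_map k i x $ lin - mouth k j $ lin\<bar> < width k"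
      unfolding mem_corridor using distinct_axes(2) by blast+
    then have "\<bar>piece_map k i x $ lin - real i * gap k\<bar> < width k" "\<bar>piece_map k i x $ lin - real j * gap k\<bar> < width k"
      unfolding mouth_lin .
    then have "\<bar>real i * gap k - real j * gap k\<bar> < gap k" using width_le_gap[of k] gap_bounds[of k] by linarith
    then have "\<bar>real i - real j\<bar> * gap k < 1 * gap k"
      using gap_bounds[of k] by (simp add: left_diff_distrib[symmetric] abs_mult)
    then have "\<bar>real i - real j\<bar> < 1" using gap_bounds[of k] by (simp only: mult_less_cancel_right)
    then have "i = j" by linarith
    then show ?thesis using x(3) kl piece_map_inj by metis
  qed
qed

section \<open>The glued homeomorphism\<close>

lemma glued_eq:
  assumes "i < corridor_count k" "x \<in> source_piece k i"
  shows "glued x = piece_map k i x"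
proof -
  define ki where "ki = (SOME ki. snd ki < corridor_count (fst ki) \<and> x \<in> source_piece (fst ki) (snd ki))"
  have "snd ki < corridor_count (fst ki) \<and> x \<in> source_piece (fst ki) (snd ki)"
    unfolding ki_def by (rule someI[of _ "(k, i)"]) (use assms in simp)
  then show ?thesis using piece_map_agree assms unfolding glued_def ki_def[symmetric] Let_def by metis
qed

lemma open_target_piece: "open (target_piece k i)"
  unfolding target_piece_def body_def corridor_def tunnel_def by (intro open_Un open_box)

lemma open_source_piece: "open (source_piece k i)"
  unfolding source_piece_def using continuous_piece_map open_target_piece by (simp add: continuous_on_open_vimage)

lemma open_target: "open target" and open_source: "open source"
  unfolding target_def source_def by (intro open_UN ballI open_target_piece open_source_piece)+

lemma sourceE:
  assumes "x \<in> source"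
  obtains k i where "i < corridor_count k" "x \<in> source_piece k i"
  using assms by (auto simp: source_def)

lemma continuous_glued: "continuous_on source glued"
proof (rule continuous_at_imp_continuous_on, rule ballI)
  fix x assume "x \<in> source"
  then obtain k i where ki: "i < corridor_count k" "x \<in> source_piece k i" by (rule sourceE)
  have "continuous_on (source_piece k i) glued"
    using continuous_on_subset[OF continuous_piece_map subset_UNIV] glued_eq[OF ki(1)]
    by (subst continuous_on_cong[OF refl]) auto
  then show "isCont glued x" using open_source_piece ki(2) continuous_on_eq_continuous_at by blast
qed

lemma inj_glued: "inj_on glued source"
proof (rule inj_onI)
  fix x y assume "x \<in> source" "y \<in> source" and eq: "glued x = glued y"
  then obtain k i l j where ki: "i < corridor_count k" "x \<in> source_piece k i" and lj: "j < corridor_count l" "y \<in> source_piece l j"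
    by (meson sourceE)
  have e: "piece_map k i x = piece_map l j y" using glued_eq ki lj eq by metis
  moreover have "piece_map k i x \<in> target_piece k i" "piece_map l j y \<in> target_piece l j" using ki lj by (auto simp: source_piece_def)
  ultimately show "x = y" using piece_map_eq_imp[of k i x l j y] ki lj by simp
qed

lemma glued_image: "glued ` source = target"
proof (intro equalityI subsetI)
  fix v assume "v \<in> glued ` source"
  then obtain x k i where "v = glued x" "i < corridor_count k" "x \<in> source_piece k i" by (auto simp: source_def)
  then show "v \<in> target" by (auto simp: target_def glued_eq source_piece_def)
next
  fix v assume "v \<in> target"
  then obtain k i where ki: "i < corridor_count k" "v \<in> target_piece k i" by (auto simp: target_def)
  obtain x where x: "piece_map k i x = v" using piece_map_surj by blast
  then have xu: "x \<in> source_piece k i" using ki by (simp add: source_piece_def)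
  then show "v \<in> glued ` source" using ki x by (intro image_eqI[of _ _ x]) (auto simp: glued_eq source_def)
qed

text \<open>Invariance of domain supplies the continuity of the inverse, so the inverses of the
  pieces never have to be glued.\<close>

lemma glued_homeomorphism: "\<exists>g. homeomorphism source target glued g"
  by (rule invariance_of_domain_homeomorphism[OF open_source continuous_glued order_refl inj_glued])
     (auto simp: glued_image)

end

section \<open>Quasiconformality\<close>

context corridors
begin

definition tube_axis' :: "nat \<Rightarrow> nat \<Rightarrow> real \<Rightarrow> real^'n" where
  "tube_axis' k i z = (end_scale (gap k) - 1) *\<^sub>R lin_pos k i + (1 - 2 * z) *\<^sub>R grid_pos k i"

lemma inverse_profile_deriv:
  assumes "0 \<le> z" "z \<le> 1"
  shows "((\<lambda>z. 1 / profile (gap k) z) has_real_derivative - (profile' (gap k) z / (profile (gap k) z)\<^sup>2)) (at z within S)"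
proof -
  have "profile (gap k) z \<noteq> 0" using profile_pos[OF gap_le_quarter assms, of k] by simp
  then show ?thesis
    by (auto intro!: derivative_eq_intros profile_deriv[OF gap_le_quarter] simp: power2_eq_square)
qed

text \<open>The slope v collects the velocity of the axis and the logarithmic derivative of the
  profile times the offset from the axis. The factor \<open>1 / profile\<close> comes out in front
  because \<open>height\<close> has the same derivative.\<close>

lemma piece_map_derivative_mid:
  fixes k i :: nat and x :: "real^'n"
  assumes h: "0 < x $ vert" "x $ vert < 1"
  defines "h \<equiv> x $ vert"
  defines "v \<equiv> - tube_axis' k i h - (profile' (gap k) h / profile (gap k) h) *\<^sub>R (x - h *\<^sub>R up - tube_axis k i h)"
  shows "(piece_map k i has_derivative (\<lambda>u. (1 / profile (gap k) h) *\<^sub>R (u + u $ vert *\<^sub>R v))) (at x)"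
proof -
  define a where "a = profile (gap k) h"
  have a: "a \<noteq> 0" using profile_pos[OF gap_le_quarter, of h k] h by (simp add: a_def h_def)
  have hh: "0 \<le> x $ vert" "x $ vert \<le> 1" using h by auto
  define G where "G y = mouth k i + (1 / profile (gap k) (y $ vert)) *\<^sub>R (y - (y $ vert) *\<^sub>R up
     - (base k + shrink (gap k) (y $ vert) *\<^sub>R lin_pos k i + (y $ vert * (1 - y $ vert)) *\<^sub>R grid_pos k i))
     + depth (gap k) (y $ vert) *\<^sub>R up" for y :: "real^'n"
  note D = has_derivative_of_coordinate[OF inverse_profile_deriv[OF hh, of k]]
    has_derivative_of_coordinate[OF depth_deriv[OF gap_le_quarter hh, of k]]
    has_derivative_of_coordinate[OF shrink_deriv[of "gap k"]]
    bounded_linear_imp_has_derivative[OF bounded_linear_vec_nth]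
  have "(G has_derivative (\<lambda>u. (1 / a) *\<^sub>R (u + u $ vert *\<^sub>R v))) (at x)"
    unfolding G_def
    by (rule has_derivative_eq_rhs, (rule derivative_intros D)+, rule ext)
       (use a in \<open>simp add: v_def tube_axis'_def h_def[symmetric] a_def[symmetric] tube_axis_def vec_eq_iff field_simps power2_eq_square\<close>)
  moreover have "open {y::real^'n. 0 < y $ vert \<and> y $ vert < 1}"
    by (intro open_Collect_conj open_Collect_less continuous_intros)
  ultimately show ?thesis unfolding a_def
    by (rule has_derivative_transform_within_open)
      (use h in \<open>auto simp: G_def piece_map_def tube_axis_def clamp01_simps height_mid[OF gap_le_quarter]\<close>)
qed

lemma lin_pos_bounds: "i < corridor_count k \<Longrightarrow> 0 \<le> lin_pos k i $ j \<and> lin_pos k i $ j \<le> 1"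
  using gap_bounds[of k] by (auto simp: lin_pos_def axis_def gap_def)

text \<open>The bound is independent of k and i. The 3 allows 1 for each of three contributions to a
  coordinate of the slope: the drift of the axis along the segment, its drift towards the grid, and
  the change of thickness.\<close>

lemma piece_map_derivative:
  assumes x: "x \<in> source_piece k i" and i: "i < corridor_count k" and h: "x $ vert \<noteq> 0" "x $ vert \<noteq> 1"
  shows "\<exists>B v. 0 \<le> B \<and> v $ vert = 0 \<and> norm v \<le> real CARD('n) * 3 \<and>
    (piece_map k i has_derivative (\<lambda>u. B *\<^sub>R (u + u $ vert *\<^sub>R v))) (at x)"
proof -
  consider "x $ vert < 0" | "0 < x $ vert" "x $ vert < 1" | "1 < x $ vert" using h by linarith
  then show ?thesis
  proof cases
    case 1
    have "(piece_map k i has_derivative (\<lambda>u. 1 *\<^sub>R (u + u $ vert *\<^sub>R 0))) (at x)"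
      by (rule has_derivative_transform_within_open[of "\<lambda>x. x" _ _ _ "{y. y $ vert < 0}"])
        (use 1 piece_map_nonpos in \<open>auto intro!: open_Collect_less continuous_intros derivative_eq_intros\<close>)
    then show ?thesis by (intro exI[of _ 1] exI[of _ 0]) auto
  next
    case 3
    let ?b = "1 / end_scale (gap k)"
    have b: "0 < ?b" using end_scale_pos[OF gap_le_quarter, of k] by simp
    have "((\<lambda>x. base k + ?b *\<^sub>R (x - (x $ vert) *\<^sub>R up - base k)
     + (depth (gap k) 1 + (x $ vert - 1) * ?b) *\<^sub>R up) has_derivative (\<lambda>u. ?b *\<^sub>R (u + u $ vert *\<^sub>R 0))) (at x)"
      by (rule has_derivative_eq_rhs, (rule derivative_intros bounded_linear_imp_has_derivative[OF bounded_linear_vec_nth])+)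
         (auto simp: fun_eq_iff algebra_simps)
    then have "(piece_map k i has_derivative (\<lambda>u. ?b *\<^sub>R (u + u $ vert *\<^sub>R 0))) (at x)"
      by (rule has_derivative_transform_within_open[of _ _ _ _ "{y. 1 < y $ vert}"])
        (use 3 piece_map_ge1 in \<open>auto intro!: open_Collect_less continuous_intros\<close>)
    then show ?thesis using b by (intro exI[of _ ?b] exI[of _ 0]) auto
  next
    case 2
    define z where "z = x $ vert"
    have z: "0 \<le> z" "z \<le> 1" using 2 by (auto simp: z_def)
    define v where "v = - tube_axis' k i z - (profile' (gap k) z / profile (gap k) z) *\<^sub>R (x - z *\<^sub>R up - tube_axis k i z)"
    have a: "0 < profile (gap k) z" by (rule profile_pos[OF gap_le_quarter z])
    have "\<bar>v $ j\<bar> \<le> 3" for j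
    proof (cases "j = vert")
      case True
      then show ?thesis by (simp add: v_def tube_axis'_def z_def)
    next
      case False
      have "\<bar>(end_scale (gap k) - 1) * lin_pos k i $ j\<bar> \<le> 1 * 1"
        unfolding abs_mult using end_scale_pos[OF gap_le_quarter, of k] end_scale_le_1[OF gap_le_quarter, of k] lin_pos_bounds[OF i, of j]
        by (intro mult_mono) auto
      moreover have "\<bar>(1 - 2 * z) * grid_pos k i $ j\<bar> \<le> 1 * 1"
        unfolding abs_mult using z grid_pos_bounds[of k i j] spread_bounds[of k] by (intro mult_mono) auto
      moreover have "\<bar>(profile' (gap k) z / profile (gap k) z) * (x $ j - tube_axis k i z $ j)\<bar> \<le> 1"
      proof -
        have d: "\<bar>x $ j - tube_axis k i z $ j\<bar> \<le> width k * profile (gap k) z"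
          using source_piece_mid[OF x 2 False] by (simp add: z_def)
        have "\<bar>(profile' (gap k) z / profile (gap k) z) * (x $ j - tube_axis k i z $ j)\<bar>
          = \<bar>profile' (gap k) z\<bar> / profile (gap k) z * \<bar>x $ j - tube_axis k i z $ j\<bar>"
          using a by (simp add: abs_mult)
        \<comment> \<open>The offset from the axis is at most \<open>width * profile\<close>, which
          cancels the denominator. The profile may thus change at rate \<open>1 / gap\<close>, since
          \<open>width / gap\<close> is small.\<close>
        also have "\<dots> \<le> (1 + 1 / gap k) / profile (gap k) z * (width k * profile (gap k) z)"
          using a profile'_le[OF gap_le_quarter z, of k] gap_bounds[of k] d
          by (intro mult_mono divide_right_mono) auto
        also have "\<dots> = width k + width k / gap k" using a by (simp add: field_simps)
        also have "\<dots> \<le> 1"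
          using width_le_spread[of k] spread_bounds[of k] spread_div_radix[of k] unfolding width_div by linarith
        finally show ?thesis .
      qed
      moreover have "v $ j = - ((end_scale (gap k) - 1) * lin_pos k i $ j) - (1 - 2 * z) * grid_pos k i $ j
         - (profile' (gap k) z / profile (gap k) z) * (x $ j - tube_axis k i z $ j)"
        using False by (simp add: v_def tube_axis'_def)
      ultimately show ?thesis by linarith
    qed
    then have "norm v \<le> real CARD('n) * 3" by (rule norm_le_card_mult)
    moreover have "(piece_map k i has_derivative (\<lambda>u. (1 / profile (gap k) z) *\<^sub>R (u + u $ vert *\<^sub>R v))) (at x)"
      using piece_map_derivative_mid[OF 2] by (simp add: v_def z_def)
    moreover have "v $ vert = 0" by (simp add: v_def tube_axis'_def z_def)
    ultimately show ?thesis using a by (intro exI[of _ "1 / profile (gap k) z"] exI[of _ v]) auto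
  qed
qed

text \<open>Along horizontal lines the map is a similarity. Along vertical lines
  \<open>clamp01\<close> confines the varying cross-sectional part to the compact unit interval,
  where it is continuously differentiable.\<close>

lemma piece_map_lipschitz_line:
  "\<exists>L. L-lipschitz_on UNIV (\<lambda>t. piece_map k i (\<chi> j. if j = d then t else x $ j))"
proof (cases "d = vert")
  case True
  define X where "X t = (\<chi> j. if j = d then t else x $ j)" for t
  define Y where "Y = x - (x $ vert) *\<^sub>R up"
  have Xv: "X t $ vert = t" for t using True by (simp add: X_def)
  have XY: "X t - t *\<^sub>R up = Y" for t
    using True by (auto simp: X_def Y_def vec_eq_iff up_def axis_def)
  define g where "g z = (1 / profile (gap k) z) *\<^sub>R (Y - tube_axis k i z)" for z
  have eq: "piece_map k i (X t) = mouth k i + g (clamp01 t) + height (gap k) t *\<^sub>R up" for t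
    unfolding piece_map_def Xv XY g_def by simp
  have "\<exists>L. L-lipschitz_on {0..1} g"
  proof (rule lipschitz_vector_derivative)
    show "(g has_vector_derivative - (profile' (gap k) z / (profile (gap k) z)\<^sup>2) *\<^sub>R (Y - tube_axis k i z)
        - (1 / profile (gap k) z) *\<^sub>R tube_axis' k i z) (at z within {0..1})" if "z \<in> {0..1}" for z
    proof -
      have z: "0 \<le> z" "z \<le> 1" using that by auto
      have "((\<lambda>z. tube_axis k i z) has_vector_derivative tube_axis' k i z) (at z within {0..1})"
        unfolding tube_axis_def tube_axis'_def
        by (rule derivative_eq_intros has_vector_derivative_scaleR shrink_deriv refl | simp)+
      from has_vector_derivative_scaleR[OF inverse_profile_deriv[OF z] has_vector_derivative_diff[OF has_vector_derivative_const this]]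
      show ?thesis unfolding g_def by (rule has_vector_derivative_eq_rhs) simp
    qed
    have "continuous_on {0..1} (profile (gap k))"
      by (rule DERIV_continuous_on[OF profile_deriv[OF gap_le_quarter]])
    then show "continuous_on {0..1} (\<lambda>z. - (profile' (gap k) z / (profile (gap k) z)\<^sup>2) *\<^sub>R (Y - tube_axis k i z)
        - (1 / profile (gap k) z) *\<^sub>R tube_axis' k i z)"
      unfolding profile'_def[OF gap_le_quarter] tube_axis_def tube_axis'_def shrink_def using profile_pos[OF gap_le_quarter] gap_bounds(1)[of k]
      by (intro continuous_intros) (auto simp: less_imp_neq[symmetric] add_pos_nonneg)
  qed
  then obtain L where L: "L-lipschitz_on UNIV (\<lambda>t. g (clamp01 t))"
    using lipschitz_comp_clamp01 by blast
  obtain M where M: "M-lipschitz_on UNIV (height (gap k))" using lipschitz_height[OF gap_le_quarter] by blast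
  have "(M * 1)-lipschitz_on UNIV (\<lambda>t. height (gap k) t *\<^sub>R up)"
    using M by (simp add: lipschitz_on_def dist_norm scaleR_diff_left[symmetric] up_def)
  from lipschitz_on_add[OF lipschitz_on_add[OF lipschitz_on_constant[of _ "mouth k i"] L] this]
  have "\<exists>L. L-lipschitz_on UNIV (\<lambda>t. piece_map k i (X t))" unfolding eq by blast
  then show ?thesis by (simp add: X_def)
next
  case False
  define X where "X t = (\<chi> j. if j = d then t else x $ j)" for t
  define B where "B = 1 / profile (gap k) (clamp01 (x $ vert))"
  have B: "0 \<le> B" using profile_clamp_pos[of k "x $ vert"] by (simp add: B_def)
  have Xv: "X t $ vert = x $ vert" for t using False by (simp add: X_def)
  have "dist (piece_map k i (X s)) (piece_map k i (X t)) = B * dist s t" for s t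
  proof -
    have "X s - X t = (s - t) *\<^sub>R axis d 1" by (auto simp: X_def vec_eq_iff axis_def)
    moreover have "piece_map k i (X s) - piece_map k i (X t) = B *\<^sub>R (X s - X t)"
      unfolding piece_map_def Xv B_def by (simp add: scaleR_diff_right)
    ultimately show ?thesis using B by (simp add: dist_norm abs_mult)
  qed
  then have "B-lipschitz_on UNIV (\<lambda>t. piece_map k i (X t))" using B by (simp add: lipschitz_on_def)
  then show ?thesis unfolding X_def by blast
qed

text \<open>Absolute continuity holds on every segment parallel to an axis, not just on almost every
  one: near each of its points the glued map coincides with a single piece.\<close>

lemma glued_abs_continuous_line:
  assumes sub: "cbox a b \<subseteq> source" and x: "x \<in> cbox a b"
  shows "abs_continuous_on_interval (\<lambda>t. glued (\<chi> j. if j = d then t else x $ j)) (a $ d) (b $ d)"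
proof -
  define X where "X t = (\<chi> j. if j = d then t else x $ j)" for t
  have contX: "continuous_on UNIV X" unfolding X_def
    by (intro continuous_on_vec_lambda, rename_tac j, case_tac "j = d") auto
  have "\<exists>e>0. \<exists>L. L-lipschitz_on (cball t e \<inter> {a $ d..b $ d}) (\<lambda>t. glued (X t))" if t: "t \<in> {a $ d..b $ d}" for t
  proof -
    have "X t \<in> cbox a b" using x t by (auto simp: X_def mem_box_cart)
    then obtain k i where ki: "i < corridor_count k" "X t \<in> source_piece k i" using sub sourceE by blast
    have "open (X -` source_piece k i)" using contX open_source_piece by (simp add: continuous_on_open_vimage)
    then obtain e where e: "e > 0" "cball t e \<subseteq> X -` source_piece k i"
      using ki(2) open_contains_cball by (metis vimageI)
    obtain L where L: "L-lipschitz_on UNIV (\<lambda>t. piece_map k i (X t))"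
      using piece_map_lipschitz_line unfolding X_def by blast
    have "L-lipschitz_on (cball t e \<inter> {a $ d..b $ d}) (\<lambda>t. glued (X t))"
    proof (rule lipschitz_on_transform[OF lipschitz_on_subset[OF L subset_UNIV]])
      show "glued (X s) = piece_map k i (X s)" if "s \<in> cball t e \<inter> {a $ d..b $ d}" for s
        using glued_eq[OF ki(1)] e(2) that by auto
    qed
    then show ?thesis using e(1) by blast
  qed
  then show ?thesis
    unfolding X_def by (rule abs_continuous_of_locally_lipschitz)
qed

lemma glued_ACL: "ACL_on glued source"
  unfolding ACL_on_def using glued_abs_continuous_line by (auto intro!: AE_I2)

text \<open>The exceptional points lie on the two hyperplanes at heights 0 and 1, where the formulas
  for the pieces change.\<close>

lemma glued_dilatation:
  "AE x in lebesgue. x \<in> source \<longrightarrow>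
     (\<exists>f'. (glued has_derivative f') (at x) \<and>
        onorm f' ^ CARD('n) \<le> (1 + real CARD('n) * 3) ^ CARD('n) * \<bar>det (matrix f')\<bar>)"
proof -
  let ?N = "{x::real^'n. x $ vert = 0} \<union> {x. x $ vert = 1}"
  have "?N \<in> null_sets lebesgue"
    using negligible_hyperplane_cart negligible_Un negligible_iff_null_sets by blast
  then show ?thesis
  proof (rule AE_I', clarsimp)
    fix x assume x: "x \<in> source" and h1: "x $ vert \<noteq> 1"
      and no: "\<forall>f'. (glued has_derivative f') (at x) \<longrightarrow>
        \<not> onorm f' ^ CARD('n) \<le> (1 + real CARD('n) * 3) ^ CARD('n) * \<bar>det (matrix f')\<bar>"
    show "x $ vert = 0"
    proof (rule ccontr)
      assume h0: "x $ vert \<noteq> 0"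
      obtain k i where ki: "i < corridor_count k" "x \<in> source_piece k i" using x by (rule sourceE)
      obtain B v where B: "0 \<le> B" "v $ vert = 0" "norm v \<le> real CARD('n) * 3"
        and D: "(piece_map k i has_derivative (\<lambda>u. B *\<^sub>R (u + u $ vert *\<^sub>R v))) (at x)"
        using piece_map_derivative[OF ki(2,1) h0 h1] by blast
      have "(glued has_derivative (\<lambda>u. B *\<^sub>R (u + u $ vert *\<^sub>R v))) (at x)"
        by (rule has_derivative_transform_within_open[OF D open_source_piece ki(2)]) (simp add: glued_eq[OF ki(1)])
      then show False using no shear_dilatation[OF B] by blast
    qed
  qed
qed

end

section \<open>Boundedness and connectedness\<close>

context corridors
begin

lemma abs_bounds_mouth: "i < corridor_count k \<Longrightarrow> 0 \<le> mouth k i $ j" "i < corridor_count k \<Longrightarrow> mouth k i $ j \<le> 1"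
proof -
  have b: "0 \<le> base k $ j" "base k $ j \<le> 1/2"
    using spread_bounds[of k] by (auto simp: base_def axis_def)
  have z: "base k $ j = 0 \<or> lin_pos k i $ j = 0" by (cases "j = off") auto
  show "i < corridor_count k \<Longrightarrow> 0 \<le> mouth k i $ j" "i < corridor_count k \<Longrightarrow> mouth k i $ j \<le> 1"
    using b z lin_pos_bounds[of i k j] by (auto simp: mouth_def)
qed

lemma depth_gap_bounds: "0 < depth (gap k) 1" "depth (gap k) 1 \<le> 3"
proof -
  have "ln (1 / gap k) \<le> 1 / gap k - 1" using gap_bounds[of k] by (intro ln_le_minus_one) auto
  then have "gap k * (2 + 3 * ln (1 / gap k)) \<le> gap k * (2 + 3 * (1 / gap k - 1))"
    using gap_bounds[of k] by (intro mult_left_mono) auto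
  also have "\<dots> \<le> 3" using gap_bounds[of k] by (simp add: algebra_simps)
  finally show "depth (gap k) 1 \<le> 3" using depth_1_le[OF gap_le_quarter, of k] by linarith
qed (rule depth_1_pos[OF gap_le_quarter])

lemma target_piece_near_mouth:
  assumes "v \<in> target_piece k i" "0 < v $ vert" "i < corridor_count k" "j \<noteq> vert"
  shows "\<bar>v $ j - mouth k i $ j\<bar> \<le> 2"
proof -
  have w: "width k \<le> 1" using width_le_spread[of k] spread_bounds[of k] by linarith
  consider "v \<in> corridor k i" | "v \<in> tunnel k" using target_piece_above[OF assms(1,2)] by blast
  then show ?thesis
  proof cases
    case 1
    then have "\<bar>v $ j - mouth k i $ j\<bar> < width k" using assms(4) by (simp add: mem_corridor)
    then show ?thesis using w by linarith
  next
    case 2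
    show ?thesis
    proof (cases "j = lin")
      case True
      then have "- width k < v $ j" "v $ j < 1 + width k" using 2 by (auto simp: mem_tunnel)
      then show ?thesis using w abs_bounds_mouth[OF assms(3), of j] by (simp add: abs_if)
    next
      case False
      then have "\<bar>v $ j - base k $ j\<bar> < width k" using 2 assms(4) by (simp add: mem_tunnel)
      then show ?thesis using w False by simp
    qed
  qed
qed

lemma target_piece_vert_less:
  assumes "v \<in> target_piece k i"
  shows "-4 < v $ vert" "v $ vert < depth (gap k) 1 + 2 * width k"
  using assms width_pos[of k] width_le_spread[of k] spread_bounds[of k] depth_gap_bounds[of k]
  by (auto simp: target_piece_def mem_body mem_corridor mem_tunnel)

lemma target_piece_bound:
  assumes v: "v \<in> target_piece k i" and i: "i < corridor_count k"
  shows "\<bar>v $ j\<bar> \<le> 5"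
proof (cases "j = vert")
  case True
  then show ?thesis
    using target_piece_vert_less[OF v] width_le_spread[of k] spread_bounds[of k] depth_gap_bounds[of k] by (simp add: abs_if)
next
  case False
  show ?thesis
  proof (cases "0 < v $ vert")
    case True
    then show ?thesis using target_piece_near_mouth[OF v True i False] abs_bounds_mouth[OF i, of j] by linarith
  next
    case h: False
    then have "v \<in> body \<or> v \<in> corridor k i" using v depth_gap_bounds[of k] by (auto simp: target_piece_def mem_tunnel)
    then show ?thesis
    proof
      assume "v \<in> body"
      then have "-1 < v $ j" "v $ j < 3" using False by (auto simp: mem_body)
      then show ?thesis by linarith
    next
      assume "v \<in> corridor k i"
      then have "\<bar>v $ j - mouth k i $ j\<bar> < width k" using False by (simp add: mem_corridor)
      then show ?thesis
        using abs_bounds_mouth[OF i, of j] width_le_spread[of k] spread_bounds[of k] by linarith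
    qed
  qed
qed

text \<open>Up to height 0 nothing moves; between 0 and 1 a tube stays within
  \<open>spread / 4\<close> of a bounded axis; above 1 the inverse contracts by
  \<open>end_scale\<close>, which is at most 1.\<close>

lemma source_piece_bound:
  assumes x: "x \<in> source_piece k i" and i: "i < corridor_count k"
  shows "\<bar>x $ j\<bar> \<le> 5"
proof -
  have v: "piece_map k i x \<in> target_piece k i" using x by (simp add: source_piece_def)
  define z where "z = clamp01 (x $ vert)"
  have z: "0 \<le> z" "z \<le> 1" using clamp01_simps by (auto simp: z_def)
  show ?thesis
  proof (cases "x $ vert \<le> 0")
    case True
    then show ?thesis using target_piece_bound[OF v i] by (simp add: piece_map_nonpos)
  next
    case pos: False
    show ?thesis
    proof (cases "j = vert")
      case True
      have "x $ vert \<le> 2"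
      proof (rule ccontr)
        assume "\<not> x $ vert \<le> 2"
        moreover have "depth (gap k) 1 + (x $ vert - 1) / end_scale (gap k) < depth (gap k) 1 + 2 * width k"
          using target_piece_vert_less(2)[OF v] height_ge1[OF gap_le_quarter, of "x $ vert" k] calculation by simp
        moreover have "x $ vert - 1 \<le> (x $ vert - 1) / end_scale (gap k)"
          using end_scale_pos[OF gap_le_quarter, of k] end_scale_le_1[OF gap_le_quarter, of k] calculation(1)
          by (simp add: le_divide_eq)
        ultimately show False using width_le_spread[of k] spread_bounds[of k] by linarith
      qed
      then show ?thesis using True pos by simp
    next
      case False
      have cc1: "\<bar>tube_axis k i z $ j\<bar> \<le> 2"
      proof -
        have "0 \<le> base k $ j" "base k $ j \<le> 1/2"
          using spread_bounds[of k] by (auto simp: base_def axis_def)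
        moreover have "\<bar>shrink (gap k) z * lin_pos k i $ j\<bar> \<le> 1 * 1"
          unfolding abs_mult using shrink_bounds[OF gap_le_quarter z, of k] lin_pos_bounds[OF i, of j]
          by (intro mult_mono) auto
        moreover have "\<bar>(z * (1 - z)) * grid_pos k i $ j\<bar> \<le> (1/4) * (1/4)"
          unfolding abs_mult[of "z * (1 - z)"]
          using parabola_bounds[OF z] grid_pos_bounds[of k i j] spread_bounds[of k] by (intro mult_mono) auto
        ultimately show ?thesis by (simp add: tube_axis_def)
      qed
      have "\<bar>x $ j - tube_axis k i z $ j\<bar> \<le> 2"
      proof (cases "x $ vert < 1")
        case True
        then have "\<bar>x $ j - tube_axis k i z $ j\<bar> < width k * profile (gap k) z"
          using source_piece_mid[OF x _ True False] pos by (simp add: z_def clamp01_simps)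
        then show ?thesis using width_profile_le_spread[OF z, of k] spread_bounds[of k] by linarith
      next
        case h: False
        have c: "0 < end_scale (gap k)" "end_scale (gap k) \<le> 1" using end_scale_pos[OF gap_le_quarter] end_scale_le_1[OF gap_le_quarter] by auto
        have z1: "z = 1" using h by (simp add: z_def clamp01_simps)
        have "\<bar>piece_map k i x $ j - mouth k i $ j\<bar> \<le> 2"
          using pos by (intro target_piece_near_mouth v i False) (simp add: height_pos_iff)
        then have "\<bar>(x $ j - tube_axis k i z $ j) / end_scale (gap k)\<bar> \<le> 2"
          by (simp add: piece_map_other[OF False] z_def[symmetric] z1 end_scale_def)
        then have "\<bar>x $ j - tube_axis k i z $ j\<bar> \<le> 2 * end_scale (gap k)"
          using c by (simp add: abs_divide pos_divide_le_eq)
        then show ?thesis using c by linarith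
      qed
      then show ?thesis using cc1 by linarith
    qed
  qed
qed

lemma bounded_target: "bounded target"
  by (rule bounded_of_coordinates[of _ 5]) (auto simp: target_def target_piece_bound)

lemma bounded_source: "bounded source"
  by (rule bounded_of_coordinates[of _ 5]) (auto simp: source_def source_piece_bound)

section \<open>Midlines of corridors and tunnels, connectedness\<close>

lemma up_nonneg: "0 \<le> up $ j" "up $ j \<le> 1" by (auto simp: up_def axis_def)

lemma ball_corridor:
  assumes "0 \<le> t" "t \<le> depth (gap k) 1 + width k"
  shows "ball (mouth k i + t *\<^sub>R up) (width k) \<subseteq> corridor k i"
  unfolding corridor_def using assms up_nonneg by (intro ball_subset_box) (auto intro: mult_right_mono)

text \<open>The midline of the tunnel, parametrised by the coordinate \<open>lin\<close>; it meets
  the axis of corridor i at the parameter \<open>i * gap\<close>.\<close>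

definition tunnel_pt :: "nat \<Rightarrow> real \<Rightarrow> real^'n" where
  "tunnel_pt k y = base k + (depth (gap k) 1 + width k) *\<^sub>R up + y *\<^sub>R axis lin 1"

lemma ball_tunnel:
  assumes "0 \<le> y" "y \<le> 1"
  shows "ball (tunnel_pt k y) (width k) \<subseteq> tunnel k"
  unfolding tunnel_def tunnel_pt_def using assms by (intro ball_subset_box) (auto simp: axis_def)

lemma tunnel_pt_corridor: "tunnel_pt k (real i * gap k) = mouth k i + (depth (gap k) 1 + width k) *\<^sub>R up"
  by (simp add: tunnel_pt_def mouth_def lin_pos_def vec_eq_iff axis_def)

lemma corridor_subset: "i < corridor_count k \<Longrightarrow> corridor k i \<subseteq> target"
  and tunnel_subset: "tunnel k \<subseteq> target" and body_subset: "body \<subseteq> target"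
  using corridor_count_ge(2)[of k] corridor_count_ge(2)[of 0] by (fastforce simp: target_def target_piece_def)+

lemma center_in_body: "center \<in> body"
  by (auto simp: mem_body center_def)

lemma connected_target_piece:
  assumes i: "i < corridor_count k"
  shows "connected (target_piece k i)"
proof -
  have c: "connected body" "connected (corridor k i)" "connected (tunnel k)"
    unfolding body_def corridor_def tunnel_def by (intro convex_connected convex_box)+
  have w: "0 < width k" "width k < 1" using width_pos[of k] width_le_spread[of k] spread_bounds[of k] by linarith+
  have "mouth k i - (width k / 2) *\<^sub>R up \<in> body \<inter> corridor k i"
    unfolding Int_iff mem_body mem_corridor using w abs_bounds_mouth[OF i] depth_gap_bounds[of k]
    by (auto simp: less_le_trans[of "-1" 0] le_less_trans[of _ 1 3] simp del: mouth_other)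
  then have 1: "connected (body \<union> corridor k i)" using c by (intro connected_Un) auto
  have "mouth k i + (depth (gap k) 1 + width k) *\<^sub>R up \<in> corridor k i"
    using ball_corridor[of "depth (gap k) 1 + width k" k i] w depth_gap_bounds[of k] by (auto simp: subset_iff)
  moreover have "mouth k i + (depth (gap k) 1 + width k) *\<^sub>R up \<in> tunnel k"
    using ball_tunnel[of "real i * gap k" k] w i gap_bounds[of k]
    unfolding tunnel_pt_corridor by (auto simp: subset_iff gap_def)
  ultimately have "(body \<union> corridor k i) \<inter> tunnel k \<noteq> {}" by blast
  then show ?thesis unfolding target_piece_def by (intro connected_Un 1 c)
qed

lemma connected_target: "connected target"
proof -
  have "target = \<Union>{target_piece k i | k i. i < corridor_count k}" by (auto simp: target_def)
  moreover have "connected (\<Union>{target_piece k i | k i. i < corridor_count k})"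
  proof (rule connected_Union)
    show "\<Inter>{target_piece k i | k i. i < corridor_count k} \<noteq> {}"
      using center_in_body by (auto simp: target_piece_def intro!: exI[of _ center])
  qed (auto simp: connected_target_piece)
  ultimately show ?thesis by simp
qed

lemma domain_target: "is_domain target"
  unfolding is_domain_def using open_target connected_target center_in_body body_subset by blast

text \<open>Connectedness is carried over from the target by the inverse homeomorphism.\<close>

lemma domain_source: "is_domain source"
proof -
  obtain g where g: "homeomorphism source target glued g" using glued_homeomorphism by blast
  then have "source = g ` target" "continuous_on target g" by (auto simp: homeomorphism_def)
  then have "connected source" "source \<noteq> {}"
    using connected_target domain_target by (auto simp: connected_continuous_image is_domain_def)
  then show ?thesis using open_source by (simp add: is_domain_def)
qed

lemma glued_quasiconformal: "quasiconformal glued source target"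
  unfolding quasiconformal_def K_quasiconformal_def
  by (rule exI[of _ "(1 + real CARD('n) * 3) ^ CARD('n)"])
    (simp add: one_le_power domain_source domain_target glued_homeomorphism glued_ACL glued_dilatation del: power_Suc)

end

section \<open>The John property\<close>

context corridors
begin

text \<open>Bounds the length of the way from any point of a tunnel or corridor to the mouth of a corridor:
  to the axis, along the tunnel to the nearest corridor, and through the corridor.\<close>

definition travel :: "nat \<Rightarrow> real" where
  "travel k = real CARD('n) * width k + gap k + depth (gap k) 1 + width k"

lemma infdist_target_ge: "ball z \<rho> \<subseteq> target \<Longrightarrow> \<rho> \<le> infdist z (frontier target)"
  using infdist_frontier_ge[OF open_target bounded_target] domain_target by (auto simp: is_domain_def)

lemma travel_bounds: "0 < travel k" "real CARD('n) * width k \<le> travel k"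
proof -
  have "0 \<le> real CARD('n) * width k" using width_pos[of k] by simp
  then show "0 < travel k" "real CARD('n) * width k \<le> travel k"
    using width_pos[of k] gap_bounds[of k] depth_gap_bounds[of k] unfolding travel_def by linarith+
qed

text \<open>This is where the exponent enters. With \<open>K = k + 1\<close> and
  \<open>q = n - 1\<close>, all quantities are exponentials of quadratics in K, and the logarithm of
  \<open>travel powr s / width\<close> is at most a constant plus
  \<open>(2 * s + l) * K - e * l * K\<^sup>2\<close>. Here \<open>e = q * s - (q + 1)\<close> is
  positive exactly when \<open>s > 1 + 1 / q\<close>, so the quadratic has a maximum, bounded by
  M.\<close>

lemma travel_powr_le:
  assumes s: "1 + 1 / (real CARD('n) - 1) < s"
  shows "\<exists>C0. \<forall>k. travel k powr s \<le> C0 * width k"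
proof -
  define q where "q = real CARD('n) - 1"
  define l where "l = ln (4::real)"
  \<comment> \<open>The terms without logarithm contribute n + 4; the logarithm contributes 6 q,
    which is at most 6 n, by \<open>ln 4 \<le> 2\<close>.\<close>
  define c where "c = 7 * real CARD('n) + 4"
  define e where "e = q * s - (q + 1)"
  have q: "2 \<le> q" using card3 by (simp add: q_def)
  have "0 < 1 / q" using q by simp
  then have s1: "1 < s" using s unfolding q_def by linarith
  have e: "0 < e"
  proof -
    have "q * (1 + 1 / q) < q * s" using s q by (intro mult_strict_left_mono) (auto simp: q_def)
    then show ?thesis using q by (simp add: e_def algebra_simps)
  qed
  have l: "0 < l" "l \<le> 2"
  proof -
    have "l = 2 * ln 2" using ln_realpow[of 2 2] by (simp add: l_def)
    then show "0 < l" "l \<le> 2" using ln_le_minus_one[of "2::real"] by auto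
  qed
  have c: "0 < c" by (simp add: c_def)
  define M where "M = (2 * s + l)\<^sup>2 / (4 * (e * l))"
  show ?thesis
  proof (intro exI[of _ "c powr s * exp M * 4"] allI)
    fix k
    define K where "K = real (k + 1)"
    have K: "1 \<le> K" by (simp add: K_def)
    have mE: "real (radix k) = exp (K\<^sup>2 * l)"
    proof -
      have "real (radix k) = (exp l) ^ ((k + 1)\<^sup>2)" by (simp add: radix_def l_def)
      also have "\<dots> = exp (real ((k + 1)\<^sup>2) * l)" by (rule exp_of_nat_mult[symmetric])
      finally show ?thesis by (simp only: K_def of_nat_power)
    qed
    have NE: "real (corridor_count k) = exp (q * K\<^sup>2 * l)"
    proof -
      have "real (corridor_count k) = real (radix k) ^ (CARD('n) - 1)" by (simp add: corridor_count_def)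
      also have "\<dots> = exp (real (CARD('n) - 1) * (K\<^sup>2 * l))" unfolding mE by (rule exp_of_nat_mult[symmetric])
      also have "real (CARD('n) - 1) = q" using card3 by (simp add: q_def)
      finally show ?thesis by (simp add: mult.assoc)
    qed
    have RE: "gap k = exp (- (q * K\<^sup>2 * l))" by (simp add: gap_def NE exp_minus inverse_eq_divide)
    have sE: "spread k = exp (- (K * l))"
    proof -
      have "(4::real) ^ (k + 1) = (exp l) ^ (k + 1)" by (simp add: l_def)
      also have "\<dots> = exp (K * l)" unfolding K_def by (rule exp_of_nat_mult[symmetric])
      finally show ?thesis by (simp add: spread_def exp_minus inverse_eq_divide)
    qed
    have wE: "width k * 4 = exp (- ((q + 1) * K\<^sup>2 * l) - K * l)"
    proof -
      have "width k * 4 = exp (- (q * K\<^sup>2 * l)) * exp (- (K * l)) / exp (K\<^sup>2 * l)"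
        by (simp add: width_def RE sE mE)
      also have "\<dots> = exp (- (q * K\<^sup>2 * l) + - (K * l) - K\<^sup>2 * l)" by (simp only: exp_add exp_diff)
      finally show ?thesis by (simp add: algebra_simps)
    qed
    have "travel k \<le> gap k * (c * K\<^sup>2)"
    proof -
      have "ln (1 / gap k) = q * K\<^sup>2 * l" by (simp add: RE ln_div)
      also have "\<dots> \<le> q * K\<^sup>2 * 2" using l q by (intro mult_left_mono) auto
      finally have "depth (gap k) 1 \<le> gap k * (2 + 3 * (q * K\<^sup>2 * 2))"
        using depth_1_le[OF gap_le_quarter, of k] gap_bounds[of k]
        by (meson add_left_mono less_imp_le mult_left_mono order_trans zero_le_numeral)
      moreover have "real CARD('n) * width k \<le> real CARD('n) * gap k"
        using width_le_gap[of k] gap_bounds[of k] by (intro mult_left_mono) auto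
      moreover have "width k \<le> gap k" using width_le_gap[of k] gap_bounds[of k] by auto
      moreover have "gap k * (real CARD('n) + 4 + 6 * q * K\<^sup>2)
          = real CARD('n) * gap k + gap k * (2 + 3 * (q * K\<^sup>2 * 2)) + 2 * gap k"
        by (simp add: algebra_simps)
      ultimately have "travel k \<le> gap k * (real CARD('n) + 4 + 6 * q * K\<^sup>2)"
        unfolding travel_def by linarith
      also have "\<dots> \<le> gap k * ((real CARD('n) + 4) * K\<^sup>2 + 6 * real CARD('n) * K\<^sup>2)"
      proof (intro mult_left_mono add_mono mult_right_mono)
        have "1 \<le> K\<^sup>2" using K by simp
        then show "real CARD('n) + 4 \<le> (real CARD('n) + 4) * K\<^sup>2" by (simp add: mult_le_cancel_left1)
      qed (use gap_bounds[of k] in \<open>auto simp: q_def\<close>)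
      finally show ?thesis by (simp add: c_def algebra_simps)
    qed
    \<comment> \<open>The polynomial loss from the logarithm becomes an exponential linear in K,
      which the quadratic term absorbs.\<close>
    also have "\<dots> \<le> gap k * (c * exp (2 * K))"
    proof (intro mult_left_mono)
      have "K \<le> exp K" using exp_ge_add_one_self[of K] by linarith
      then have "K\<^sup>2 \<le> (exp K)\<^sup>2" using K by (intro power_mono) auto
      then show "K\<^sup>2 \<le> exp (2 * K)" by (simp add: exp_double)
    qed (use gap_bounds[of k] c in auto)
    also have "\<dots> = c * exp (2 * K - q * K\<^sup>2 * l)"
      by (simp add: RE exp_diff exp_minus field_simps)
    finally have "travel k powr s \<le> (c * exp (2 * K - q * K\<^sup>2 * l)) powr s"
      using travel_bounds(1)[of k] s1 by (intro powr_mono2) auto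
    also have "\<dots> = c powr s * exp (s * (2 * K - q * K\<^sup>2 * l))"
      using c by (simp add: powr_mult powr_def[of "exp _"])
    also have "\<dots> \<le> c powr s * exp (M + (- ((q + 1) * K\<^sup>2 * l) - K * l))"
    proof -
      have "(2 * s + l) * K - (e * l) * K\<^sup>2 \<le> M"
        unfolding M_def using e l by (intro quadratic_le) auto
      then have "s * (2 * K - q * K\<^sup>2 * l) \<le> M + (- ((q + 1) * K\<^sup>2 * l) - K * l)"
        by (simp add: e_def algebra_simps)
      then show ?thesis by (intro mult_left_mono) auto
    qed
    also have "\<dots> = c powr s * exp M * 4 * width k"
      unfolding exp_add wE[symmetric] by simp
    finally show "travel k powr s \<le> c powr s * exp M * 4 * width k" .
  qed
qed

context
  fixes s C0 :: real
  assumes s1: "1 \<le> s" and C0: "\<And>k. travel k powr s \<le> C0 * width k"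
begin

definition reach :: real where "reach = real CARD('n) * 2"
text \<open>One summand for each situation: legs in corridors and tunnels, starting points in the
  body, and the passage through a mouth into the body.\<close>

definition john_const :: real where
  "john_const = C0 + reach powr s + 2 powr s * (C0 * (reach + 2) + reach powr s)"

lemma C0_nonneg: "0 \<le> C0"
proof -
  have "0 \<le> C0 * width 0" using C0[of 0] powr_ge_zero[of "travel 0" s] by linarith
  then show ?thesis using width_pos[of 0] by (simp add: zero_le_mult_iff)
qed

lemma reach_pos: "0 < reach" by (simp add: reach_def)

lemma john_const_ge: "C0 \<le> john_const" "reach powr s \<le> john_const"
  "2 powr s * (C0 * (reach + 2) + reach powr s) \<le> john_const" "0 \<le> john_const"
  using C0_nonneg reach_pos by (auto simp: john_const_def intro!: add_nonneg_nonneg)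

lemma dist_center:
  assumes "\<And>j. \<bar>x $ j - center $ j\<bar> \<le> 2"
  shows "dist x center \<le> reach"
  using norm_le_card_mult[of "x - center" 2] assms by (simp add: dist_norm reach_def)

lemma center_nth: "center $ j = (if j = vert then -2 else 1)" by (auto simp: center_def)

lemma ball_center: "ball center 2 \<subseteq> body"
  unfolding body_def by (rule ball_subset_box) auto

text \<open>The body is convex and contains the ball of radius 2 about its center, so the clearance
  at parameter \<tau> is at least \<open>2 * \<tau>\<close>; it may be assumed when checking the
  John inequality.\<close>

lemma john_toward_center:
  assumes x: "\<And>j. \<bar>x $ j - center $ j\<bar> \<le> 2" and "x \<in> target" and L: "0 \<le> L"
    and leg: "\<And>\<tau>. 0 \<le> \<tau> \<Longrightarrow> \<tau> \<le> 1 \<Longrightarrow> 2 * \<tau> \<le> infdist (linepath x center \<tau>) (frontier target) \<Longrightarrow>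
      (L + \<tau> * dist x center) powr s \<le> john_const * infdist (linepath x center \<tau>) (frontier target)"
  shows "john_curve john_const s target center L x"
proof -
  have sub: "ball (linepath x center \<tau>) (2 * \<tau>) \<subseteq> body" if \<tau>: "0 \<le> \<tau>" "\<tau> \<le> 1" for \<tau>
  proof -
    have "x \<in> cbox (center - vec 2) (center + vec 2)"
      using x by (auto simp: mem_box_cart abs_le_iff algebra_simps)
    then have "ball (linepath x center \<tau>) (\<tau> * 2) \<subseteq> cbox (center - vec 2) (center + vec 2)"
      using ball_center box_subset_cbox \<tau> unfolding body_def
      by (intro ball_toward_subset_convex convex_box) blast+
    \<comment> \<open>The starting point may be a mouth, on the boundary of the body. Convexity is
      therefore used in the closed box, and openness of the ball leads back to the open one.\<close>
    then have "ball (linepath x center \<tau>) (\<tau> * 2) \<subseteq> interior (cbox (center - vec 2) (center + vec 2))"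
      by (intro interior_maximal open_ball)
    then show ?thesis by (simp add: body_def interior_cbox mult.commute)
  qed
  have leg': "(L + \<tau> * dist x center) powr s \<le> john_const * infdist (linepath x center \<tau>) (frontier target)"
    if \<tau>: "0 \<le> \<tau>" "\<tau> \<le> 1" for \<tau>
    using sub[OF \<tau>] body_subset by (intro leg \<tau> infdist_target_ge) auto
  show ?thesis
  proof (rule john_curve_segment[OF _ _ leg'])
    show "john_curve john_const s target center (L + dist x center) center"
      using leg'[of 1] center_in_body body_subset by (intro john_curve_center) (auto simp: linepath_1')
    show "closed_segment x center \<subseteq> target"
    proof
      fix z assume "z \<in> closed_segment x center"
      then obtain \<tau> where \<tau>: "0 \<le> \<tau>" "\<tau> \<le> 1" "z = linepath x center \<tau>"
        by (auto simp: in_segment linepath_def)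
      show "z \<in> target"
      proof (cases "\<tau> = 0")
        case True then show ?thesis using \<tau> assms(2) by (simp add: linepath_0')
      next
        case False
        then have "z \<in> ball (linepath x center \<tau>) (2 * \<tau>)" using \<tau> by simp
        then show ?thesis using sub[OF \<tau>(1,2)] body_subset by blast
      qed
    qed
  qed
qed

lemma john_body:
  assumes x: "x \<in> body"
  shows "john_curve john_const s target center 0 x"
proof (rule john_toward_center)
  have "-4 < x $ vert" "x $ vert < 0" "\<And>j. j \<noteq> vert \<Longrightarrow> -1 < x $ j" "\<And>j. j \<noteq> vert \<Longrightarrow> x $ j < 3"
    using x by (auto simp: mem_body)
  then show near: "\<bar>x $ j - center $ j\<bar> \<le> 2" for j
    by (cases "j = vert") (force simp: center_nth abs_le_iff)+
  show "x \<in> target" using x body_subset by blast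
  fix \<tau> :: real
  assume \<tau>: "0 \<le> \<tau>" "\<tau> \<le> 1" and d: "2 * \<tau> \<le> infdist (linepath x center \<tau>) (frontier target)"
  have "(0 + \<tau> * dist x center) powr s \<le> (\<tau> * reach) powr s"
    using \<tau> dist_center[OF near] s1 by (intro powr_mono2) (auto intro: mult_left_mono)
  also have "\<dots> = reach powr s * \<tau> powr s" using \<tau> reach_pos by (simp add: powr_mult)
  also have "\<dots> \<le> john_const * infdist (linepath x center \<tau>) (frontier target)"
    using powr_le_self[OF s1 \<tau>] d \<tau> john_const_ge by (intro mult_mono) auto
  finally show "(0 + \<tau> * dist x center) powr s \<le> john_const * infdist (linepath x center \<tau>) (frontier target)" .
qed simp

text \<open>Just inside the body the clearance \<open>2 * \<tau>\<close> is too small for a path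
  that has already covered \<open>travel\<close>, while the clearance \<open>width\<close> of the
  mouth fades as the path moves away. Adding \<open>width - \<tau> * reach \<le> d\<close> and a
  multiple of \<open>2 * \<tau> \<le> d\<close> gives \<open>width \<le> (reach + 2) * d\<close>
  throughout.\<close>

lemma john_mouth:
  assumes i: "i < corridor_count k" and L: "0 \<le> L" "L \<le> travel k"
  shows "john_curve john_const s target center L (mouth k i)"
proof -
  have near: "\<bar>mouth k i $ j - center $ j\<bar> \<le> 2" for j
    using abs_bounds_mouth[OF i, of j] by (cases "j = vert") (auto simp: center_nth abs_le_iff simp del: mouth_other)
  have bw: "ball (mouth k i) (width k) \<subseteq> target"
    using ball_corridor[of 0 k i] corridor_subset[OF i] depth_gap_bounds[of k] width_pos[of k] by auto
  have "john_curve john_const s target center (travel k) (mouth k i)"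
  proof (rule john_toward_center[OF near])
    show "mouth k i \<in> target" using bw width_pos[of k] by auto
    show "0 \<le> travel k" using travel_bounds(1)[of k] by simp
    fix \<tau> :: real
    define d where "d = infdist (linepath (mouth k i) center \<tau>) (frontier target)"
    assume \<tau>: "0 \<le> \<tau>" "\<tau> \<le> 1" and "2 * \<tau> \<le> infdist (linepath (mouth k i) center \<tau>) (frontier target)"
    then have d: "2 * \<tau> \<le> d" by (simp add: d_def)
    have dE: "dist (mouth k i) center \<le> reach" by (rule dist_center[OF near])
    have "dist (mouth k i) (linepath (mouth k i) center \<tau>) = \<tau> * dist (mouth k i) center"
      using dist_linepath[of "mouth k i" center 0 \<tau>] \<tau> by (simp add: linepath_0')
    then have "dist (mouth k i) (linepath (mouth k i) center \<tau>) \<le> \<tau> * reach"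
      using dE \<tau> by (simp add: mult_left_mono)
    then have "ball (linepath (mouth k i) center \<tau>) (width k - \<tau> * reach) \<subseteq> ball (mouth k i) (width k)"
      by (subst ball_subset_ball_iff) (simp add: dist_commute)
    then have "width k - \<tau> * reach \<le> d" using bw unfolding d_def by (intro infdist_target_ge) blast
    moreover have "2 * \<tau> * reach \<le> d * reach" using d reach_pos by (intro mult_right_mono) auto
    ultimately have wd: "width k \<le> (reach + 2) * d" "\<tau> \<le> d" "0 \<le> d"
      using d \<tau> width_pos[of k] by (auto simp: algebra_simps)
    \<comment> \<open>A sum is at most twice the maximum; this separates the length travelled before
      the mouth from the length travelled in the body.\<close>
    have "(travel k + \<tau> * dist (mouth k i) center) powr s \<le> (2 * max (travel k) (\<tau> * reach)) powr s"
      using travel_bounds(1)[of k] \<tau> s1 mult_left_mono[OF dE \<tau>(1)] by (intro powr_mono2) auto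
    also have "\<dots> = 2 powr s * max (travel k) (\<tau> * reach) powr s"
      using travel_bounds(1)[of k] by (simp add: powr_mult)
    also have "\<dots> \<le> 2 powr s * (travel k powr s + (\<tau> * reach) powr s)"
      by (intro mult_left_mono) (auto simp: max_def)
    also have "\<dots> \<le> 2 powr s * (C0 * width k + reach powr s * \<tau>)"
    proof -
      have "(\<tau> * reach) powr s = reach powr s * \<tau> powr s" using \<tau> reach_pos by (simp add: powr_mult)
      also have "\<dots> \<le> reach powr s * \<tau>" by (intro mult_left_mono powr_le_self s1 \<tau>) auto
      finally show ?thesis using C0[of k] by (intro mult_left_mono add_mono) auto
    qed
    also have "\<dots> \<le> 2 powr s * (C0 * ((reach + 2) * d) + reach powr s * d)"
      using wd C0_nonneg by (intro mult_left_mono add_mono) auto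
    also have "\<dots> = 2 powr s * (C0 * (reach + 2) + reach powr s) * d" by (simp add: algebra_simps)
    also have "\<dots> \<le> john_const * d" using john_const_ge wd by (intro mult_right_mono) auto
    finally show "(travel k + \<tau> * dist (mouth k i) center) powr s \<le> john_const * infdist (linepath (mouth k i) center \<tau>) (frontier target)"
      by (simp add: d_def)
  qed
  then show ?thesis by (rule john_curve_mono) (use L s1 in auto)
qed

text \<open>For legs along a midline: the clearance is \<open>width\<close> all the way, so the
  hypothesis on C0 applies as long as the total length stays within \<open>travel\<close>.\<close>

lemma john_thick_leg:
  assumes seg: "\<And>z. z \<in> closed_segment x y \<Longrightarrow> ball z (width k) \<subseteq> target"
    and L: "0 \<le> L" "L + dist x y \<le> travel k" and J: "john_curve john_const s target center (L + dist x y) y"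
  shows "john_curve john_const s target center L x"
proof (rule john_curve_segment[OF J])
  show "closed_segment x y \<subseteq> target" using seg width_pos[of k] by (meson centre_in_ball subsetD subsetI)
  fix \<tau> :: real assume \<tau>: "0 \<le> \<tau>" "\<tau> \<le> 1"
  then have "linepath x y \<tau> \<in> closed_segment x y" by (auto simp: linepath_def in_segment)
  then have d: "width k \<le> infdist (linepath x y \<tau>) (frontier target)" by (intro infdist_target_ge seg)
  have "\<tau> * dist x y \<le> dist x y" using \<tau> by (intro mult_left_le_one_le) auto
  then have "(L + \<tau> * dist x y) powr s \<le> travel k powr s" using L s1 \<tau> by (intro powr_mono2) auto
  also have "\<dots> \<le> C0 * width k" by (rule C0)
  also have "\<dots> \<le> john_const * infdist (linepath x y \<tau>) (frontier target)"
    using d john_const_ge C0_nonneg width_pos[of k] by (intro mult_mono) auto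
  finally show "(L + \<tau> * dist x y) powr s \<le> john_const * infdist (linepath x y \<tau>) (frontier target)" .
qed

text \<open>The starting point may be arbitrarily close to the boundary. Length and clearance both
  grow in proportion to \<tau>, and \<open>\<tau> powr s \<le> \<tau>\<close> for
  \<open>s \<ge> 1\<close>.\<close>

lemma john_first_leg:
  assumes S: "convex S" "S \<subseteq> target" "x \<in> S" "ball q (width k) \<subseteq> S"
    and d: "dist x q \<le> travel k" and J: "john_curve john_const s target center (dist x q) q"
  shows "john_curve john_const s target center 0 x"
proof (rule john_curve_segment)
  show "john_curve john_const s target center (0 + dist x q) q" using J by simp
  have "q \<in> S" using S(4) width_pos[of k] by auto
  then show "closed_segment x q \<subseteq> target" using S closed_segment_subset by blast
  fix \<tau> :: real assume \<tau>: "0 \<le> \<tau>" "\<tau> \<le> 1"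
  have "ball (linepath x q \<tau>) (\<tau> * width k) \<subseteq> target"
    using ball_toward_subset_convex[OF S(1,3,4) \<tau>] S(2) by blast
  then have i: "\<tau> * width k \<le> infdist (linepath x q \<tau>) (frontier target)" by (rule infdist_target_ge)
  have "(0 + \<tau> * dist x q) powr s \<le> (\<tau> * travel k) powr s"
    using \<tau> d s1 by (intro powr_mono2) (auto intro: mult_left_mono)
  also have "\<dots> = \<tau> powr s * travel k powr s" using \<tau> travel_bounds(1)[of k] by (simp add: powr_mult)
  also have "\<dots> \<le> \<tau> * (C0 * width k)" using powr_le_self[OF s1 \<tau>] C0[of k] \<tau> by (intro mult_mono) auto
  also have "\<dots> = C0 * (\<tau> * width k)" by simp
  also have "\<dots> \<le> john_const * infdist (linepath x q \<tau>) (frontier target)"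
    using i john_const_ge C0_nonneg width_pos[of k] \<tau> by (intro mult_mono) auto
  finally show "(0 + \<tau> * dist x q) powr s \<le> john_const * infdist (linepath x q \<tau>) (frontier target)" .
qed

lemma norm_up [simp]: "norm up = 1" by (simp add: up_def)

lemma john_corridor_axis:
  assumes i: "i < corridor_count k" and t: "0 \<le> t" "t \<le> depth (gap k) 1 + width k"
    and L: "0 \<le> L" "L + t \<le> travel k"
  shows "john_curve john_const s target center L (mouth k i + t *\<^sub>R up)"
proof -
  have d: "dist (mouth k i + t *\<^sub>R up) (mouth k i) = t" using t by (simp add: dist_norm)
  show ?thesis
  proof (rule john_thick_leg[where y = "mouth k i" and k = k])
    fix z assume "z \<in> closed_segment (mouth k i + t *\<^sub>R up) (mouth k i)"
    then obtain u where u: "0 \<le> u" "u \<le> 1" "z = (1 - u) *\<^sub>R (mouth k i + t *\<^sub>R up) + u *\<^sub>R mouth k i"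
      by (auto simp: in_segment)
    then have z: "z = mouth k i + ((1 - u) * t) *\<^sub>R up" by (simp add: algebra_simps)
    have "(1 - u) * t \<le> t" using u t by (intro mult_left_le_one_le) auto
    then have "ball z (width k) \<subseteq> corridor k i" unfolding z using u t by (intro ball_corridor) auto
    then show "ball z (width k) \<subseteq> target" using corridor_subset[OF i] by blast
  qed (use L t john_mouth[OF i] d in auto)
qed

lemma john_tunnel_axis:
  assumes y: "0 \<le> y" "y \<le> 1" and L: "0 \<le> L" "L + gap k + depth (gap k) 1 + width k \<le> travel k"
  shows "john_curve john_const s target center L (tunnel_pt k y)"
proof -
  have N: "0 < real (corridor_count k)" using corridor_count_ge[of k] by simp
  \<comment> \<open>The floor of \<open>y * N\<close> selects the corridor. At y = 1 it would be one
    past the last index, so the last corridor is taken, at distance exactly \<open>gap\<close>,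
    which \<open>travel\<close> allows for.\<close>
  obtain i where i: "i < corridor_count k" "\<bar>y - real i * gap k\<bar> \<le> gap k"
  proof (cases "y = 1")
    case True
    have "\<bar>y - real (corridor_count k - 1) * gap k\<bar> \<le> gap k"
      using corridor_count_ge[of k] True by (simp add: gap_def of_nat_diff field_simps)
    then show ?thesis using corridor_count_ge[of k] by (intro that[of "corridor_count k - 1"]) auto
  next
    case False
    define i where "i = nat \<lfloor>y * real (corridor_count k)\<rfloor>"
    have fl: "real i \<le> y * real (corridor_count k)" "y * real (corridor_count k) < real i + 1"
      using y N by (auto simp: i_def)
    have "y * real (corridor_count k) < 1 * real (corridor_count k)" using y False N by (intro mult_strict_right_mono) auto
    then have "real i < real (corridor_count k)" using fl by linarith
    moreover have "\<bar>y - real i * gap k\<bar> \<le> gap k"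
    proof -
      have "real i * gap k \<le> y" "y \<le> (real i + 1) * gap k"
        using fl N by (auto simp: gap_def pos_divide_le_eq pos_le_divide_eq)
      then show ?thesis by (simp add: abs_le_iff algebra_simps)
    qed
    ultimately show ?thesis by (intro that[of i]) auto
  qed
  define y' where "y' = real i * gap k"
  have y': "0 \<le> y'" "y' \<le> 1" using i gap_bounds[of k] by (auto simp: y'_def gap_def)
  have d: "dist (tunnel_pt k y) (tunnel_pt k y') = \<bar>y - y'\<bar>"
    by (simp add: tunnel_pt_def dist_norm scaleR_diff_left[symmetric])
  show ?thesis
  proof (rule john_thick_leg[where y = "tunnel_pt k y'" and k = k])
    fix z assume "z \<in> closed_segment (tunnel_pt k y) (tunnel_pt k y')"
    then obtain u where u: "0 \<le> u" "u \<le> 1" "z = (1 - u) *\<^sub>R tunnel_pt k y + u *\<^sub>R tunnel_pt k y'"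
      by (auto simp: in_segment)
    then have z: "z = tunnel_pt k ((1 - u) * y + u * y')" by (simp add: tunnel_pt_def algebra_simps)
    have "(1 - u) * y + u * y' \<le> 1" using u y y' by (intro convex_bound_le) auto
    then have "ball z (width k) \<subseteq> tunnel k" unfolding z using u y y' by (intro ball_tunnel) auto
    then show "ball z (width k) \<subseteq> target" using tunnel_subset by blast
  next
    show "john_curve john_const s target center (L + dist (tunnel_pt k y) (tunnel_pt k y')) (tunnel_pt k y')"
    proof -
      have "john_curve john_const s target center (L + \<bar>y - y'\<bar>) (mouth k i + (depth (gap k) 1 + width k) *\<^sub>R up)"
        using i L depth_gap_bounds[of k] width_pos[of k] y'_def by (intro john_corridor_axis) auto
      then show ?thesis unfolding d by (simp add: y'_def tunnel_pt_corridor)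
    qed
  qed (use L i d depth_gap_bounds[of k] width_pos[of k] y'_def in auto)
qed

lemma john_corridor:
  assumes i: "i < corridor_count k" and x: "x \<in> corridor k i"
  shows "john_curve john_const s target center 0 x"
proof -
  define t where "t = max 0 (min (x $ vert) (depth (gap k) 1 + width k))"
  define q where "q = mouth k i + t *\<^sub>R up"
  have t: "0 \<le> t" "t \<le> depth (gap k) 1 + width k"
    using depth_gap_bounds[of k] width_pos[of k] by (auto simp: t_def)
  have xs: "- width k < x $ vert" "x $ vert < depth (gap k) 1 + 2 * width k"
    "\<And>j. j \<noteq> vert \<Longrightarrow> \<bar>x $ j - mouth k i $ j\<bar> < width k"
    using x by (auto simp: mem_corridor)
  have "\<bar>x $ j - q $ j\<bar> \<le> width k" for j
  proof (cases "j = vert")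
    case True
    then show ?thesis using xs(1,2) depth_gap_bounds[of k] width_pos[of k] by (auto simp: q_def t_def)
  next
    case False
    then show ?thesis using xs(3)[OF False] by (simp add: q_def del: mouth_other)
  qed
  then have d: "dist x q \<le> real CARD('n) * width k"
    unfolding dist_norm by (intro norm_le_card_mult) simp
  show ?thesis
  proof (rule john_first_leg[of "corridor k i"])
    show "convex (corridor k i)" by (simp add: corridor_def convex_box)
    show "ball q (width k) \<subseteq> corridor k i" unfolding q_def by (rule ball_corridor[OF t])
    show "dist x q \<le> travel k" using d travel_bounds(2)[of k] by linarith
    show "john_curve john_const s target center (dist x q) q" unfolding q_def
      using d t gap_bounds[of k] by (intro john_corridor_axis i) (auto simp: q_def travel_def)
  qed (use x corridor_subset[OF i] in auto)
qed

lemma john_tunnel: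
  assumes x: "x \<in> tunnel k"
  shows "john_curve john_const s target center 0 x"
proof -
  define y where "y = clamp01 (x $ lin)"
  define q where "q = tunnel_pt k y"
  have y: "0 \<le> y" "y \<le> 1" using clamp01_simps by (auto simp: y_def)
  have xs: "depth (gap k) 1 < x $ vert" "x $ vert < depth (gap k) 1 + 2 * width k"
    "- width k < x $ lin" "x $ lin < 1 + width k"
    "\<And>j. j \<noteq> vert \<Longrightarrow> j \<noteq> lin \<Longrightarrow> \<bar>x $ j - base k $ j\<bar> < width k"
    using x by (auto simp: mem_tunnel)
  have "\<bar>x $ j - q $ j\<bar> \<le> width k" for j
  proof -
    consider "j = vert" | "j = lin" | "j \<noteq> vert" "j \<noteq> lin" by blast
    then show ?thesis
    proof cases
      case 1
      then show ?thesis using xs by (auto simp: q_def tunnel_pt_def axis_def)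
    next
      case 2
      then show ?thesis using xs width_pos[of k] by (auto simp: q_def tunnel_pt_def axis_def y_def clamp01_def)
    next
      case 3
      then show ?thesis using xs(5)[OF 3] by (simp add: q_def tunnel_pt_def axis_def)
    qed
  qed
  then have d: "dist x q \<le> real CARD('n) * width k"
    unfolding dist_norm by (intro norm_le_card_mult) simp
  show ?thesis
  proof (rule john_first_leg[of "tunnel k"])
    show "convex (tunnel k)" by (simp add: tunnel_def convex_box)
    show "ball q (width k) \<subseteq> tunnel k" unfolding q_def by (rule ball_tunnel[OF y])
    show "dist x q \<le> travel k" using d travel_bounds(2)[of k] by linarith
    show "john_curve john_const s target center (dist x q) q" unfolding q_def
      using d by (intro john_tunnel_axis y) (auto simp: q_def travel_def)
  qed (use x tunnel_subset in auto)
qed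

lemma s_John_target: "s_John_domain s target"
proof (rule s_John_domainI[OF s1 domain_target bounded_target])
  show "center \<in> target" using center_in_body body_subset by blast
  fix x assume "x \<in> target"
  then obtain k i where "i < corridor_count k" "x \<in> body \<or> x \<in> corridor k i \<or> x \<in> tunnel k"
    by (auto simp: target_def target_piece_def)
  then show "john_curve john_const s target center 0 x" using john_body john_corridor john_tunnel by blast
qed

end

lemma target_s_John:
  assumes s: "1 + 1 / (real CARD('n) - 1) < s"
  shows "s_John_domain s target"
proof -
  obtain C0 where C0: "\<And>k. travel k powr s \<le> C0 * width k" using travel_powr_le[OF s] by blast
  have "0 \<le> 1 / (real CARD('n) - 1)" using card3 by simp
  then have "1 \<le> s" using s by linarith
  then show ?thesis using C0 by (rule s_John_target)
qed

section \<open>Failure of uniform continuity\<close>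

text \<open>The segment \<open>X\<close> in the source lies \<open>c * width\<close> above height 1,
  in the region where the map is a similarity of ratio \<open>1 / c\<close>, and is mapped onto the
  midline of the tunnel. Its length c is also its internal length; corridor 0 stands for all of
  them, since the map no longer depends on the index there.\<close>

lemma close_pair:
  "\<exists>x\<in>source. \<exists>y\<in>source. internal_dist source x y \<le> ennreal (end_scale (gap k)) \<and> dist (glued x) (glued y) = 1"
proof -
  define c where "c = end_scale (gap k)"
  have c: "0 < c" using end_scale_pos[OF gap_le_quarter] by (simp add: c_def)
  define X where "X t = base k + (t * c) *\<^sub>R axis lin 1 + (1 + c * width k) *\<^sub>R up" for t
  have Xv: "X t $ vert = 1 + c * width k" for t by (simp add: X_def axis_def)
  have N: "0 < corridor_count k" using corridor_count_ge by simp
  have F: "piece_map k 0 (X t) = tunnel_pt k t" for t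
  proof -
    have h: "1 \<le> X t $ vert" unfolding Xv using c width_pos[of k] by simp
    have "X t - (1 + c * width k) *\<^sub>R up - base k = (t * c) *\<^sub>R axis lin 1" by (simp add: X_def)
    then show ?thesis using c unfolding piece_map_ge1[OF h] Xv c_def[symmetric]
      by (simp add: tunnel_pt_def)
  qed
  have U: "X t \<in> source_piece k 0" if "0 \<le> t" "t \<le> 1" for t
  proof -
    have "tunnel_pt k t \<in> tunnel k"
      using ball_tunnel[OF that, of k] width_pos[of k] centre_in_ball[of "tunnel_pt k t" "width k"] by blast
    then show ?thesis by (simp add: source_piece_def F target_piece_def)
  qed
  then have sub: "X t \<in> source" if "0 \<le> t" "t \<le> 1" for t using that N by (auto simp: source_def)
  have "closed_segment (X 0) (X 1) \<subseteq> source"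
  proof
    fix z assume "z \<in> closed_segment (X 0) (X 1)"
    then obtain u where u: "0 \<le> u" "u \<le> 1" "z = (1 - u) *\<^sub>R X 0 + u *\<^sub>R X 1" by (auto simp: in_segment)
    then have "z = X u" by (simp add: X_def algebra_simps)
    then show "z \<in> source" using sub u by simp
  qed
  then have "internal_dist source (X 0) (X 1) \<le> ennreal (dist (X 0) (X 1))" by (rule internal_dist_le_dist)
  moreover have "dist (X 0) (X 1) = c" using c by (simp add: X_def dist_norm)
  moreover have "dist (glued (X 0)) (glued (X 1)) = 1"
    using U[of 0] U[of 1] N by (simp add: glued_eq F tunnel_pt_def dist_norm)
  ultimately show ?thesis using sub[of 0] sub[of 1] by (auto simp: c_def)
qed

lemma end_scale_small:
  assumes "0 < \<delta>"
  shows "\<exists>k. end_scale (gap k) < \<delta>"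
proof -
  obtain k where k: "2 / \<delta> < real k" using reals_Archimedean2 by blast
  have "k + 1 \<le> (k + 1)\<^sup>2" by (simp add: power2_eq_square)
  also have "\<dots> < 4 ^ ((k + 1)\<^sup>2)" by (rule power_gt_expt) simp
  also have "\<dots> \<le> corridor_count k" unfolding corridor_count_def radix_def[symmetric]
    using card3 radix_ge(2)[of k] by (intro self_le_power) auto
  finally have "real k < real (corridor_count k)" by simp
  then have "2 / \<delta> < real (corridor_count k)" using k by linarith
  then have "2 * gap k < \<delta>" using assms corridor_count_ge(2)[of k] by (simp add: gap_def field_simps)
  then show ?thesis using end_scale_le[OF gap_le_quarter, of k] by (intro exI[of _ k]) linarith
qed

lemma glued_not_uniformly_continuous:
  "\<not> (\<forall>\<epsilon>::real. \<epsilon> > 0 \<longrightarrow> (\<exists>\<delta>::real. \<delta> > 0 \<and>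
      (\<forall>x\<in>source. \<forall>y\<in>source. internal_dist source x y < ennreal \<delta> \<longrightarrow> dist (glued x) (glued y) < \<epsilon>)))"
proof
  assume "\<forall>\<epsilon>::real. \<epsilon> > 0 \<longrightarrow> (\<exists>\<delta>::real. \<delta> > 0 \<and>
      (\<forall>x\<in>source. \<forall>y\<in>source. internal_dist source x y < ennreal \<delta> \<longrightarrow> dist (glued x) (glued y) < \<epsilon>))"
  then obtain \<delta> :: real where d: "\<delta> > 0"
    and uc: "\<And>x y. x \<in> source \<Longrightarrow> y \<in> source \<Longrightarrow> internal_dist source x y < ennreal \<delta> \<Longrightarrow> dist (glued x) (glued y) < 1"
    using zero_less_one by metis
  obtain k where k: "end_scale (gap k) < \<delta>" using end_scale_small[OF d] by blast
  obtain x y where xy: "x \<in> source" "y \<in> source" "internal_dist source x y \<le> ennreal (end_scale (gap k))" "dist (glued x) (glued y) = 1"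
    using close_pair by blast
  have "internal_dist source x y < ennreal \<delta>"
    using xy(3) ennreal_lessI[OF d k] by (rule le_less_trans)
  then show False using uc[OF xy(1,2)] xy(4) by simp
qed

end

theorem theorem1p4:
  assumes "CARD('n::finite) \<ge> 3"
  shows "\<exists>(\<Omega>' :: (real^'n) set) (\<Omega> :: (real^'n) set) f.
           is_domain \<Omega>' \<and> bounded \<Omega>' \<and> is_domain \<Omega> \<and>
           (\<forall>s::real. 1 + 1 / (real CARD('n) - 1) < s \<longrightarrow> s_John_domain s \<Omega>) \<and>
           quasiconformal f \<Omega>' \<Omega> \<and>
           \<not> (\<forall>\<epsilon>::real. \<epsilon> > 0 \<longrightarrow> (\<exists>\<delta>::real. \<delta> > 0 \<and>
                (\<forall>x\<in>\<Omega>'. \<forall>y\<in>\<Omega>'. internal_dist \<Omega>' x y < ennreal \<delta> \<longrightarrow> dist (f x) (f y) < \<epsilon>)))"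
proof -
  obtain r :: "'n \<Rightarrow> nat" where r: "bij_betw r UNIV {0..<CARD('n)}"
    using ex_bij_betw_finite_nat[of "UNIV :: 'n set"] by auto
  interpret corridors r
    by unfold_locales (use r assms in \<open>simp_all add: lessThan_atLeast0\<close>)
  show ?thesis
    using domain_source bounded_source domain_target target_s_John glued_quasiconformal
      glued_not_uniformly_continuous by blast
qed

end
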